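(* (1) Consider a finite horizon Markov decision process (MDP) with horizon $N$, state space $\mathcal{X}=\{1,\dots,X\}$, action space $\mathcal{U}=\{1,\dots,U\}$, transition probabilities $P_{ij}(u,k)$, costs $c(i,u,k)$ and terminal cost $c_N(i)$, satisfying: (A1) for each $u$ and $k$ the cost $c(x,u,k)$ is decreasing in $x$, and the terminal cost $c_N(x)$ is decreasing in $x$; (A2) $P_i(u,k)\le_s P_{i+1}(u,k)$ for each $i$, $u$ (and time $k$), where $P_i(u,k)$ denotes the $i$-th row of the transition matrix $P(u,k)$; (A3) $c(x,u,k)$ is submodular in $(x,u)$ at each time $k$, i.e. $c(x,u+1,k)-c(x,u,k)$ is decreasing in $x$; (A4) $P_{ij}(u,k)$ is tail-sum supermodular in $(i,u)$, i.e. for each $l$, $\sum_{j\ge l}\big(P_{ij}(u+1,k)-P_{ij}(u,k)\big)$ is increasing in $i$. Then at each time $k=0,1,\dots,N-1$ there exists an optimal policy $\mu^*_k(x)$ that is increasing in the state $x\in\mathcal{X}$. (2) Consider an infinite horizon discounted cost MDP, or a unichain average cost MDP, with time invariant costs $c(x,u)$ and transition matrices $P(u)$ (and no terminal cost), satisfying the time-invariant versions of (A1), (A2), (A3) and (A4). Then there exists an optimal stationary policy $\mu^*(x)$ that is increasing in the state $x\in\mathcal{X}$.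
   Context: "Increasing" and "decreasing" are meant in the weak sense. For probability vectors $p,q$ on $\{1,\dots,X\}$, first order stochastic dominance $p\ge_s q$ (equivalently $q\le_s p$) means $\sum_{i\ge j}p(i)\ge\sum_{i\ge j}q(i)$ for all $j$. In the finite horizon MDP the objective to be minimized over policies $u_k=\mu_k(x_k)$ is $\mathbb{E}\{\sum_{k=0}^{N-1}c(x_k,u_k,k)+c_N(x_N)\mid x_0\}$, where $P_{ij}(u,k)=\mathbb{P}(x_{k+1}=j\mid x_k=i,u_k=u)$. Optimal policies are given by Bellman's equation: $J_N(i)=c_N(i)$, $Q_k(i,u)=c(i,u,k)+\sum_j P_{ij}(u,k)J_{k+1}(j)$, $J_k(i)=\min_{u\in\mathcal{U}}Q_k(i,u)$, $\mu^*_k(i)\in\arg\min_{u\in\mathcal{U}}Q_k(i,u)$. *)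

theory Defs
  imports "HOL-Probability.Probability"
begin

text \<open>
  States are the elements of \<open>{1..X}\<close>, actions those of \<open>{1..U}\<close>. The row \<open>P\<^sub>i(u,k)\<close> of
  the transition matrix is the pmf \<open>P k i u\<close>, so \<open>P\<^sub>i\<^sub>j(u,k) = pmf (P k i u) j\<close>; the stage cost
  \<open>c(i,u,k)\<close> is \<open>c k i u\<close> and a policy is written \<open>\<mu> k i\<close>. For time invariant data the
  argument \<open>k\<close> is dropped.
\<close>

definition transitions_within :: "nat \<Rightarrow> nat \<Rightarrow> (nat \<Rightarrow> nat \<Rightarrow> nat pmf) \<Rightarrow> bool" where
  "transitions_within X U P \<longleftrightarrow> (\<forall>i\<in>{1..X}. \<forall>u\<in>{1..U}. set_pmf (P i u) \<subseteq> {1..X})"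


subsection \<open>Structural conditions\<close>

definition stoch_dom_le :: "nat \<Rightarrow> nat pmf \<Rightarrow> nat pmf \<Rightarrow> bool" where
  "stoch_dom_le X q p \<longleftrightarrow> (\<forall>j\<in>{1..X}. (\<Sum>i=j..X. pmf q i) \<le> (\<Sum>i=j..X. pmf p i))"

definition decreasing_cost :: "nat \<Rightarrow> nat \<Rightarrow> (nat \<Rightarrow> nat \<Rightarrow> real) \<Rightarrow> bool" where
  "decreasing_cost X U c \<longleftrightarrow> (\<forall>u\<in>{1..U}. antimono_on {1..X} (\<lambda>x. c x u))"

definition stoch_increasing :: "nat \<Rightarrow> nat \<Rightarrow> (nat \<Rightarrow> nat \<Rightarrow> nat pmf) \<Rightarrow> bool" where
  "stoch_increasing X U P \<longleftrightarrow>
     (\<forall>u\<in>{1..U}. \<forall>i\<in>{1..<X}. stoch_dom_le X (P i u) (P (i + 1) u))"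

definition submodular_cost :: "nat \<Rightarrow> nat \<Rightarrow> (nat \<Rightarrow> nat \<Rightarrow> real) \<Rightarrow> bool" where
  "submodular_cost X U c \<longleftrightarrow> (\<forall>u\<in>{1..<U}. antimono_on {1..X} (\<lambda>x. c x (u + 1) - c x u))"

definition tail_sum_supermodular :: "nat \<Rightarrow> nat \<Rightarrow> (nat \<Rightarrow> nat \<Rightarrow> nat pmf) \<Rightarrow> bool" where
  "tail_sum_supermodular X U P \<longleftrightarrow>
     (\<forall>u\<in>{1..<U}. \<forall>l\<in>{1..X}.
        mono_on {1..X} (\<lambda>i. \<Sum>j=l..X. (pmf (P i (u + 1)) j - pmf (P i u) j)))"


subsection \<open>Law of the controlled state process\<close>

abbreviation discrete_states :: "nat \<Rightarrow> nat measure" where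
  "discrete_states \<equiv> \<lambda>_. count_space UNIV"

definition controlled_kernel ::
  "(nat \<Rightarrow> nat \<Rightarrow> nat \<Rightarrow> nat pmf) \<Rightarrow> (nat \<Rightarrow> nat \<Rightarrow> nat) \<Rightarrow> nat \<Rightarrow> nat \<Rightarrow> (nat \<Rightarrow> nat) \<Rightarrow> nat measure"
where
  "controlled_kernel P \<mu> x0 n \<omega> =
     measure_pmf (case n of 0 \<Rightarrow> return_pmf x0 | Suc k \<Rightarrow> P k (\<omega> k) (\<mu> k (\<omega> k)))"

text \<open>
  The distribution of \<open>(x\<^sub>0, x\<^sub>1, \<dots>)\<close> on trajectory space, given \<open>x\<^sub>0\<close> and \<open>u\<^sub>k = \<mu>\<^sub>k(x\<^sub>k)\<close>,
  obtained from the Ionescu-Tulcea theorem.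
\<close>

definition trajectory_law ::
  "(nat \<Rightarrow> nat \<Rightarrow> nat \<Rightarrow> nat pmf) \<Rightarrow> (nat \<Rightarrow> nat \<Rightarrow> nat) \<Rightarrow> nat \<Rightarrow> (nat \<Rightarrow> nat) measure" where
  "trajectory_law P \<mu> x0 =
     projective_family.lim UNIV (Ionescu_Tulcea.CI (controlled_kernel P \<mu> x0) discrete_states)
       discrete_states"

lemma Ionescu_Tulcea_controlled_kernel:
  "Ionescu_Tulcea (controlled_kernel P \<mu> x0) discrete_states"
proof (rule Ionescu_Tulcea.intro)
  fix i
  show "controlled_kernel P \<mu> x0 i
      \<in> measurable (PiM {0..<i} discrete_states) (subprob_algebra (count_space UNIV))"
  proof (cases i)
    case 0
    then show ?thesis
      by (simp add: controlled_kernel_def[abs_def] measure_pmf_in_subprob_algebra)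
  next
    case (Suc k)
    have "(\<lambda>\<omega>. \<omega> k) \<in> measurable (PiM {0..<i} discrete_states) (count_space UNIV)"
      using Suc by (intro measurable_component_singleton) simp
    moreover have "(\<lambda>x. measure_pmf (P k x (\<mu> k x)))
        \<in> measurable (count_space UNIV) (subprob_algebra (count_space UNIV))"
      by (simp add: measure_pmf_in_subprob_algebra)
    ultimately have "(\<lambda>\<omega>. measure_pmf (P k (\<omega> k) (\<mu> k (\<omega> k))))
        \<in> measurable (PiM {0..<i} discrete_states) (subprob_algebra (count_space UNIV))"
      by (rule measurable_compose)
    with Suc show ?thesis
      by (simp add: controlled_kernel_def[abs_def])
  qed
next
  fix i \<omega>
  show "prob_space (controlled_kernel P \<mu> x0 i \<omega>)"
    by (simp add: controlled_kernel_def measure_pmf.prob_space_axioms)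
qed


lemma trajectory_law_restrict:
  "distr (trajectory_law P \<mu> x0) (PiM {0..<n} discrete_states) (\<lambda>\<omega>. restrict \<omega> {0..<n}) =
     Ionescu_Tulcea.CI (controlled_kernel P \<mu> x0) discrete_states {0..<n}"
proof -
  interpret Ionescu_Tulcea "controlled_kernel P \<mu> x0" discrete_states
    by (rule Ionescu_Tulcea_controlled_kernel)
  show ?thesis
    unfolding trajectory_law_def by (rule distr_lim) simp
qed


subsection \<open>Policies and optimality\<close>

text \<open>Policies \<open>u\<^sub>k = \<mu>\<^sub>k(x\<^sub>k)\<close> at the decision times \<open>k \<in> T\<close>.\<close>

definition policies :: "nat set \<Rightarrow> nat \<Rightarrow> nat \<Rightarrow> (nat \<Rightarrow> nat \<Rightarrow> nat) set" where
  "policies T X U = (T \<rightarrow> {1..X} \<rightarrow> {1..U})"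

definition optimal_policy ::
  "nat \<Rightarrow> (nat \<Rightarrow> nat \<Rightarrow> nat) set \<Rightarrow> ((nat \<Rightarrow> nat \<Rightarrow> nat) \<Rightarrow> nat \<Rightarrow> 'r::linorder) \<Rightarrow>
    (nat \<Rightarrow> nat \<Rightarrow> nat) \<Rightarrow> bool"
where
  "optimal_policy X M J \<mu> \<longleftrightarrow> \<mu> \<in> M \<and> (\<forall>\<nu>\<in>M. \<forall>x0\<in>{1..X}. J \<mu> x0 \<le> J \<nu> x0)"

definition finite_horizon_cost ::
  "nat \<Rightarrow> (nat \<Rightarrow> nat \<Rightarrow> nat \<Rightarrow> nat pmf) \<Rightarrow> (nat \<Rightarrow> nat \<Rightarrow> nat \<Rightarrow> real) \<Rightarrow> (nat \<Rightarrow> real) \<Rightarrow>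
    (nat \<Rightarrow> nat \<Rightarrow> nat) \<Rightarrow> nat \<Rightarrow> real"
where
  "finite_horizon_cost N P c cN \<mu> x0 =
     (\<integral>\<omega>. (\<Sum>k<N. c k (\<omega> k) (\<mu> k (\<omega> k))) + cN (\<omega> N) \<partial>trajectory_law P \<mu> x0)"

definition discounted_cost ::
  "real \<Rightarrow> (nat \<Rightarrow> nat \<Rightarrow> nat pmf) \<Rightarrow> (nat \<Rightarrow> nat \<Rightarrow> real) \<Rightarrow> (nat \<Rightarrow> nat \<Rightarrow> nat) \<Rightarrow> nat \<Rightarrow> real"
where
  "discounted_cost \<rho> P c \<mu> x0 =
     (\<integral>\<omega>. (\<Sum>k. \<rho> ^ k * c (\<omega> k) (\<mu> k (\<omega> k))) \<partial>trajectory_law (\<lambda>_. P) \<mu> x0)"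

definition average_cost ::
  "(nat \<Rightarrow> nat \<Rightarrow> nat pmf) \<Rightarrow> (nat \<Rightarrow> nat \<Rightarrow> real) \<Rightarrow> (nat \<Rightarrow> nat \<Rightarrow> nat) \<Rightarrow> nat \<Rightarrow> ereal"
where
  "average_cost P c \<mu> x0 =
     limsup (\<lambda>n. ereal ((\<integral>\<omega>. (\<Sum>k<n. c (\<omega> k) (\<mu> k (\<omega> k))) \<partial>trajectory_law (\<lambda>_. P) \<mu> x0) / real n))"


subsection \<open>Bellman's equation\<close>

function bellman_J ::
  "nat \<Rightarrow> nat \<Rightarrow> nat \<Rightarrow> (nat \<Rightarrow> nat \<Rightarrow> nat \<Rightarrow> nat pmf) \<Rightarrow> (nat \<Rightarrow> nat \<Rightarrow> nat \<Rightarrow> real) \<Rightarrow> (nat \<Rightarrow> real) \<Rightarrow>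
    nat \<Rightarrow> nat \<Rightarrow> real"
where
  "bellman_J X U N P c cN k i =
     (if k < N
      then Min ((\<lambda>u. c k i u + (\<Sum>j=1..X. pmf (P k i u) j * bellman_J X U N P c cN (Suc k) j)) ` {1..U})
      else cN i)"
  by pat_completeness auto
termination
  by (relation "Wellfounded.measure (\<lambda>(X, U, N, P, c, cN, k, i). N - k)") auto

declare bellman_J.simps [simp del]

definition bellman_Q ::
  "nat \<Rightarrow> nat \<Rightarrow> nat \<Rightarrow> (nat \<Rightarrow> nat \<Rightarrow> nat \<Rightarrow> nat pmf) \<Rightarrow> (nat \<Rightarrow> nat \<Rightarrow> nat \<Rightarrow> real) \<Rightarrow> (nat \<Rightarrow> real) \<Rightarrow>
    nat \<Rightarrow> nat \<Rightarrow> nat \<Rightarrow> real"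
where
  "bellman_Q X U N P c cN k i u =
     c k i u + (\<Sum>j=1..X. pmf (P k i u) j * bellman_J X U N P c cN (Suc k) j)"

definition bellman_policy ::
  "nat \<Rightarrow> nat \<Rightarrow> nat \<Rightarrow> (nat \<Rightarrow> nat \<Rightarrow> nat \<Rightarrow> nat pmf) \<Rightarrow> (nat \<Rightarrow> nat \<Rightarrow> nat \<Rightarrow> real) \<Rightarrow> (nat \<Rightarrow> real) \<Rightarrow>
    (nat \<Rightarrow> nat \<Rightarrow> nat) \<Rightarrow> bool"
where
  "bellman_policy X U N P c cN \<mu> \<longleftrightarrow>
     (\<forall>k<N. \<forall>i\<in>{1..X}. is_arg_min (bellman_Q X U N P c cN k i) (\<lambda>u. u \<in> {1..U}) (\<mu> k i))"


subsection \<open>Unichain condition\<close>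

text \<open>
  A state is recurrent if the chain started there returns almost surely. Unichain means that under
  every stationary policy the recurrent states form a single communicating class, the remaining
  states being transient.
\<close>

definition recurrent_states :: "nat \<Rightarrow> (nat \<Rightarrow> nat \<Rightarrow> nat pmf) \<Rightarrow> (nat \<Rightarrow> nat) \<Rightarrow> nat set" where
  "recurrent_states X P \<mu> =
     {i \<in> {1..X}. AE \<omega> in trajectory_law (\<lambda>_. P) (\<lambda>_. \<mu>) i. \<exists>n\<ge>1. \<omega> n = i}"

definition accessible :: "nat \<Rightarrow> (nat \<Rightarrow> nat \<Rightarrow> nat pmf) \<Rightarrow> (nat \<Rightarrow> nat) \<Rightarrow> (nat \<times> nat) set" where
  "accessible X P \<mu> = {(i, j). i \<in> {1..X} \<and> j \<in> set_pmf (P i (\<mu> i))}\<^sup>*"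

definition unichain :: "nat \<Rightarrow> nat \<Rightarrow> (nat \<Rightarrow> nat \<Rightarrow> nat pmf) \<Rightarrow> bool" where
  "unichain X U P \<longleftrightarrow>
     (\<forall>\<mu>\<in>{1..X} \<rightarrow> {1..U}.
        recurrent_states X P \<mu> \<noteq> {} \<and>
        recurrent_states X P \<mu> \<times> recurrent_states X P \<mu> \<subseteq> accessible X P \<mu>)"

end

theory Submission
  imports Defs
begin

text \<open>
  Summation by parts turns the sum of \<open>P\<^sub>i\<^sub>j(u) V(j)\<close> over \<open>j\<close> into the tail sums of \<open>P\<^sub>i(u)\<close> weighted by the
  increments of \<open>V\<close>. So if \<open>V\<close> is decreasing, the state-action value \<open>Q\<close> is decreasing in the state and
  submodular; the minimum over the actions is again decreasing and the largest minimiser is increasing.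
  Backward induction settles the finite horizon, and value iteration the discounted problem.

  For the average cost, let \<open>\<rho> \<rightarrow> 1\<close> along a sequence on which the greedy policy \<open>\<mu>\<close> is constant
  (there are finitely many stationary policies) and \<open>(1 - \<rho>) V\<^sub>\<rho>\<close> converges to some \<open>g\<close>. Then
  \<open>g \<le> P(u) g\<close> for all actions, with equality for \<open>\<mu>\<close>. Summing the discounted Bellman inequality for
  a fixed \<open>\<rho>\<close> along a trajectory shows that no policy has average cost below \<open>g\<close>, while \<open>\<mu>\<close> attains \<open>g\<close>.
\<close>

subsection \<open>Marginals of the trajectory law\<close>

text \<open>Every cost considered is a sum of functions of single coordinates, so only the
  one-dimensional marginals of the trajectory law matter. They are computed here by the forward
  recursion of the chain.\<close>

primrec state_pmf ::
  "(nat \<Rightarrow> nat \<Rightarrow> nat \<Rightarrow> nat pmf) \<Rightarrow> (nat \<Rightarrow> nat \<Rightarrow> nat) \<Rightarrow> nat \<Rightarrow> nat \<Rightarrow> nat pmf"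
where
  "state_pmf P \<mu> x0 0 = return_pmf x0"
| "state_pmf P \<mu> x0 (Suc k) = bind_pmf (state_pmf P \<mu> x0 k) (\<lambda>i. P k i (\<mu> k i))"

lemma sets_trajectory_law:
  "sets (trajectory_law P \<mu> x0) = sets (PiM UNIV discrete_states)"
proof -
  interpret Ionescu_Tulcea "controlled_kernel P \<mu> x0" discrete_states
    by (rule Ionescu_Tulcea_controlled_kernel)
  show ?thesis
    unfolding trajectory_law_def by (rule PF.sets_lim)
qed

lemma measurable_trajectory_component [measurable]:
  "(\<lambda>\<omega>. \<omega> n) \<in> measurable (trajectory_law P \<mu> x0) (count_space UNIV)"
  unfolding measurable_cong_sets[OF sets_trajectory_law refl] by (rule measurable_component_singleton) auto

text \<open>In the Ionescu-Tulcea construction \<open>C 0 n\<close> is the joint law of the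
  coordinates below \<open>n\<close>. The kernel that appends coordinate \<open>Suc n\<close> looks
  only at coordinate \<open>n\<close>, so the recursion closes on the marginals and becomes that of
  \<open>state_pmf\<close>.\<close>

lemma distr_trajectory_law:
  "distr (trajectory_law P \<mu> x0) (count_space UNIV) (\<lambda>\<omega>. \<omega> n) = measure_pmf (state_pmf P \<mu> x0 n)"
proof -
  interpret Ionescu_Tulcea "controlled_kernel P \<mu> x0" discrete_states
    by (rule Ionescu_Tulcea_controlled_kernel)
  let ?C = "\<lambda>n. C 0 n (\<lambda>_. undefined)"
  have sets_C': "sets (?C n) = sets (PiM {0..<n} discrete_states)" for n
    using sets_C[of "\<lambda>_. undefined" 0 n] by simp
  have space_C': "space (?C n) \<noteq> {}" for n
    using prob_space_C[of "\<lambda>_. undefined" 0 n, THEN prob_space.not_empty] by simp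
  have comp: "(\<lambda>\<omega>. \<omega> k) \<in> measurable (PiM {0..<n} discrete_states) (count_space UNIV)" if "k < n" for k n :: nat
    using that by (intro measurable_component_singleton) auto
  have upd: "fun_upd \<omega> n \<in> measurable (measure_pmf p) (PiM {0..<Suc n} discrete_states)"
    if "\<omega> \<in> space (PiM {0..<n} discrete_states)" for \<omega> n and p :: "nat pmf"
    using that by (auto simp: space_PiM PiE_iff extensional_def)
  \<comment> \<open>\<open>eP n \<omega>\<close> extends the history by a fresh coordinate drawn
    from the kernel; projecting on it gives the kernel back.\<close>
  have last: "distr (eP n \<omega>) (count_space UNIV) (\<lambda>\<omega>. \<omega> n) = controlled_kernel P \<mu> x0 n \<omega>"
    if "\<omega> \<in> space (PiM {0..<n} discrete_states)" for \<omega> n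
  proof -
    have "distr (eP n \<omega>) (count_space UNIV) (\<lambda>\<omega>. \<omega> n) = distr (controlled_kernel P \<mu> x0 n \<omega>) (count_space UNIV) (\<lambda>x. x)"
      unfolding eP_def controlled_kernel_def
      by (subst distr_distr[OF comp upd]) (use that in \<open>auto simp: comp_def\<close>)
    also have "\<dots> = controlled_kernel P \<mu> x0 n \<omega>"
      by (rule distr_id2) (simp add: controlled_kernel_def)
    finally show ?thesis .
  qed
  have step: "distr (?C (Suc n)) (count_space UNIV) (\<lambda>\<omega>. \<omega> n) = ?C n \<bind> controlled_kernel P \<mu> x0 n" for n
  proof -
    have "distr (?C (Suc n)) (count_space UNIV) (\<lambda>\<omega>. \<omega> n) =
      ?C n \<bind> (\<lambda>\<omega>. distr (eP n \<omega>) (count_space UNIV) (\<lambda>\<omega>. \<omega> n))"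
      using space_C'
      by (simp, subst distr_bind[where K = "PiM {0..<Suc n} discrete_states"])
         (auto intro!: comp simp: measurable_cong_sets[OF sets_C' refl])
    also have "\<dots> = ?C n \<bind> controlled_kernel P \<mu> x0 n"
      by (intro bind_cong refl last) (simp add: sets_eq_imp_space_eq[OF sets_C'])
    finally show ?thesis .
  qed
  \<comment> \<open>\<open>?C n\<close> covers only the times below \<open>n\<close>, so time
    \<open>n\<close> is first visible in \<open>?C (Suc n)\<close>.\<close>
  have marginal: "distr (?C (Suc n)) (count_space UNIV) (\<lambda>\<omega>. \<omega> n) = measure_pmf (state_pmf P \<mu> x0 n)"
  proof (induction n)
    case 0
    show ?case
      unfolding step
      by (subst C.simps(1), subst bind_return[OF P]) (auto simp: controlled_kernel_def space_PiM)
  next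
    case (Suc n)
    have "distr (?C (Suc (Suc n))) (count_space UNIV) (\<lambda>\<omega>. \<omega> (Suc n)) =
      ?C (Suc n) \<bind> (\<lambda>\<omega>. measure_pmf (P n (\<omega> n) (\<mu> n (\<omega> n))))"
      unfolding step by (simp add: controlled_kernel_def[abs_def])
    \<comment> \<open>The integrand depends on the history through its last coordinate only, so the
      bind factors through the marginal to which the induction hypothesis applies.\<close>
    also have "\<dots> = distr (?C (Suc n)) (count_space UNIV) (\<lambda>\<omega>. \<omega> n) \<bind> (\<lambda>i. measure_pmf (P n i (\<mu> n i)))"
      by (rule bind_distr[symmetric, where K="count_space UNIV"])
         (auto intro!: comp space_C' simp: measurable_cong_sets[OF sets_C' refl] measure_pmf_in_subprob_algebra simp del: C.simps)
    finally show ?case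
      by (simp add: Suc.IH measure_pmf_bind del: C.simps)
  qed
  have restr: "(\<lambda>f. restrict f {0..<Suc n}) \<in> measurable M (PiM {0..<Suc n} discrete_states)"
    if "sets M = sets (PiM J discrete_states)" "{0..<Suc n} \<subseteq> J" for M J
    unfolding measurable_cong_sets[OF that(1) refl] by (rule measurable_restrict_subset) (rule that)
  \<comment> \<open>\<open>CI J\<close> restricts \<open>C\<close>, run up to the least bound of
    \<open>J\<close>; for an initial segment this bound is its length.\<close>
  have up: "up_to {0..<Suc n} = Suc n"
    by (rule antisym) (auto simp: up_to_iff_Ico,
      metis up_to_less finite_atLeastLessThan atLeastLessThan_iff le0 lessI Suc_leI)
  have "distr (trajectory_law P \<mu> x0) (count_space UNIV) (\<lambda>\<omega>. \<omega> n) =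
     distr (distr (trajectory_law P \<mu> x0) (PiM {0..<Suc n} discrete_states) (\<lambda>\<omega>. restrict \<omega> {0..<Suc n}))
       (count_space UNIV) (\<lambda>\<omega>. \<omega> n)"
    by (subst distr_distr[OF comp restr[OF sets_trajectory_law]]) (auto simp: comp_def)
  also have "\<dots> = distr (?C (Suc n)) (count_space UNIV) (\<lambda>\<omega>. \<omega> n)"
    unfolding trajectory_law_restrict CI_def up
    by (subst distr_distr[OF comp restr[OF sets_C']]) (auto simp: comp_def)
  finally show ?thesis
    using marginal by simp
qed

lemma trajectory_integral:
  fixes f :: "nat \<Rightarrow> real"
  shows "(\<integral>\<omega>. f (\<omega> n) \<partial>trajectory_law P \<mu> x0) = measure_pmf.expectation (state_pmf P \<mu> x0 n) f"
  unfolding distr_trajectory_law[symmetric] by (rule integral_distr[symmetric]) auto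

lemma set_state_pmf:
  assumes "x0 \<in> {1..X}" and "\<And>k i. k < n \<Longrightarrow> i \<in> {1..X} \<Longrightarrow> set_pmf (P k i (\<mu> k i)) \<subseteq> {1..X}"
  shows "set_pmf (state_pmf P \<mu> x0 n) \<subseteq> {1..X}"
  using assms
proof (induction n)
  case (Suc n)
  then have "set_pmf (state_pmf P \<mu> x0 n) \<subseteq> {1..X}"
    by auto
  moreover have "set_pmf (P n i (\<mu> n i)) \<subseteq> {1..X}" if "i \<in> {1..X}" for i
    using Suc.prems(2)[of n i] that by simp
  ultimately show ?case
    unfolding state_pmf.simps set_bind_pmf by (intro UN_least) blast
qed simp

subsection \<open>Monotonicity of the dynamic programming operator\<close>

definition action_value ::
  "nat \<Rightarrow> (nat \<Rightarrow> nat \<Rightarrow> real) \<Rightarrow> (nat \<Rightarrow> nat \<Rightarrow> nat pmf) \<Rightarrow> (nat \<Rightarrow> real) \<Rightarrow> nat \<Rightarrow> nat \<Rightarrow> real"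
where
  "action_value X c P V i u = c i u + (\<Sum>j=1..X. pmf (P i u) j * V j)"

definition state_value :: "nat \<Rightarrow> (nat \<Rightarrow> nat \<Rightarrow> real) \<Rightarrow> nat \<Rightarrow> real" where
  "state_value U Q i = Min (Q i ` {1..U})"

definition greedy :: "nat \<Rightarrow> (nat \<Rightarrow> nat \<Rightarrow> real) \<Rightarrow> nat \<Rightarrow> nat" where
  "greedy U Q i = Max {u \<in> {1..U}. Q i u = state_value U Q i}"

lemma greedy:
  assumes "1 \<le> U"
  shows greedy_in: "greedy U Q i \<in> {1..U}" and greedy_value: "Q i (greedy U Q i) = state_value U Q i"
proof -
  have "state_value U Q i \<in> Q i ` {1..U}"
    unfolding state_value_def using assms by (intro Min_in) auto
  then have "{u \<in> {1..U}. Q i u = state_value U Q i} \<noteq> {}"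
    by auto
  then have "greedy U Q i \<in> {u \<in> {1..U}. Q i u = state_value U Q i}"
    unfolding greedy_def by (intro Max_in) auto
  then show "greedy U Q i \<in> {1..U}" "Q i (greedy U Q i) = state_value U Q i"
    by auto
qed

lemma state_value_le: "u \<in> {1..U} \<Longrightarrow> state_value U Q i \<le> Q i u"
  unfolding state_value_def by (intro Min_le) auto

lemma le_state_value_iff:
  "1 \<le> U \<Longrightarrow> z \<le> state_value U Q i \<longleftrightarrow> (\<forall>u\<in>{1..U}. z \<le> Q i u)"
  unfolding state_value_def by (subst Min_ge_iff) auto

lemma antimono_on_state_value:
  assumes "1 \<le> U" and "\<And>u. u \<in> {1..U} \<Longrightarrow> antimono_on A (\<lambda>i. Q i u)"
  shows "antimono_on A (state_value U Q)"
proof (rule monotone_onI)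
  fix i j assume "i \<in> A" "j \<in> A" "i \<le> j"
  then have "state_value U Q j \<le> Q i u" if "u \<in> {1..U}" for u
    using state_value_le[OF that, of Q j] monotone_onD[OF assms(2)[OF that], of i j] by simp
  then show "state_value U Q j \<le> state_value U Q i"
    using assms(1) by (simp add: le_state_value_iff)
qed

text \<open>
  Ties are broken in favour of the largest minimiser: if the greedy action at a larger state were
  strictly smaller, the decreasing differences would make the larger action optimal there as well.
\<close>

lemma mono_on_greedy:
  assumes U: "1 \<le> U"
    and sub: "\<And>u. u \<in> {1..<U} \<Longrightarrow> antimono_on A (\<lambda>i. Q i (u + 1) - Q i u)"
  shows "mono_on A (greedy U Q)"
proof (rule mono_onI, rule ccontr)
  fix i j assume ij: "i \<in> A" "j \<in> A" "i \<le> j" and "\<not> greedy U Q i \<le> greedy U Q j"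
  define u where "u = greedy U Q i"
  define v where "v = greedy U Q j"
  have vu: "v < u" and u: "u \<in> {1..U}" and v: "v \<in> {1..U}"
    using \<open>\<not> _ \<le> _\<close> greedy_in[OF U] by (auto simp: u_def v_def)
  \<comment> \<open>Decreasing differences are given for neighbouring actions only; telescoping
    carries them over to the pair \<open>v < u\<close>.\<close>
  have "Q j u - Q j v = (\<Sum>w=v..<u. Q j (w + 1) - Q j w)"
    using vu by (simp add: sum_Suc_diff')
  also have "\<dots> \<le> (\<Sum>w=v..<u. Q i (w + 1) - Q i w)"
    using u v ij by (intro sum_mono monotone_onD[OF sub]) auto
  also have "\<dots> = Q i u - Q i v"
    using vu by (simp add: sum_Suc_diff')
  also have "\<dots> \<le> 0"
    using state_value_le[OF v, of Q i] greedy_value[OF U, of Q i] by (simp add: u_def)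
  finally have "Q j u \<le> state_value U Q j"
    using greedy_value[OF U, of Q j] by (simp add: v_def)
  then have "Q j u = state_value U Q j"
    using state_value_le[OF u, of Q j] by simp
  then have "u \<le> v"
    unfolding v_def greedy_def using u by (intro Max_ge) auto
  with vu show False by simp
qed

section \<open>Summation by parts and stochastic dominance\<close>

lemma sum_mult_by_tails:
  fixes p V :: "nat \<Rightarrow> real"
  assumes "1 \<le> X"
  shows "(\<Sum>j=1..X. p j * V j) =
    V 1 * (\<Sum>j=1..X. p j) + (\<Sum>l=2..X. (V l - V (l - 1)) * (\<Sum>j=l..X. p j))"
  using assms
proof (induction X rule: dec_induct)
  case (step n)
  have tele: "(\<Sum>l=2..Suc n. V l - V (l - 1)) = V (Suc n) - V 1"
    using step(1) by (induction n rule: dec_induct) auto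
  \<comment> \<open>Passing to \<open>Suc n\<close> adds \<open>p (Suc n)\<close> to each tail. The
    tail up to \<open>n\<close> at \<open>l = Suc n\<close> is empty, and the weights in front of
    \<open>p (Suc n)\<close> telescope by \<open>tele\<close>.\<close>
  have "(\<Sum>l=2..Suc n. (V l - V (l - 1)) * (\<Sum>j=l..Suc n. p j)) =
    (\<Sum>l=2..Suc n. (V l - V (l - 1)) * (\<Sum>j=l..n. p j) + (V l - V (l - 1)) * p (Suc n))"
    by (intro sum.cong) (auto simp: algebra_simps)
  also have "\<dots> = (\<Sum>l=2..n. (V l - V (l - 1)) * (\<Sum>j=l..n. p j)) + (V (Suc n) - V 1) * p (Suc n)"
    using step(1) unfolding sum.distrib sum_distrib_right[symmetric] tele by simp
  finally show ?case
    using step by (simp add: algebra_simps)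
qed simp

text \<open>Equal totals make the terms with \<open>V 1\<close> agree, and each remaining tail is
  weighted by an increment of \<open>V\<close>, which is at most 0. The weights are arbitrary reals
  so that both probability rows and differences of two rows (total 0) can be inserted.\<close>

lemma sum_mult_antimono_le:
  fixes p q V :: "nat \<Rightarrow> real"
  assumes X: "1 \<le> X" and V: "antimono_on {1..X} V"
    and total: "(\<Sum>j=1..X. p j) = (\<Sum>j=1..X. q j)"
    and tails: "\<And>l. l \<in> {1..X} \<Longrightarrow> (\<Sum>j=l..X. p j) \<le> (\<Sum>j=l..X. q j)"
  shows "(\<Sum>j=1..X. q j * V j) \<le> (\<Sum>j=1..X. p j * V j)"
proof -
  have "(V l - V (l - 1)) * (\<Sum>j=l..X. q j) \<le> (V l - V (l - 1)) * (\<Sum>j=l..X. p j)"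
    if "l \<in> {2..X}" for l
  proof (rule mult_left_mono_neg)
    show "V l - V (l - 1) \<le> 0"
      using that monotone_onD[OF V, of "l - 1" l] by force
  qed (use that in \<open>auto intro!: tails\<close>)
  then show ?thesis
    unfolding sum_mult_by_tails[OF X] using total by (auto intro: sum_mono)
qed

lemma sum_pmf_row:
  "transitions_within X U P \<Longrightarrow> i \<in> {1..X} \<Longrightarrow> u \<in> {1..U} \<Longrightarrow> (\<Sum>j=1..X. pmf (P i u) j) = 1"
  unfolding transitions_within_def by (intro sum_pmf_eq_1) auto

text \<open>The assumption compares neighbouring states; chaining it covers any two ordered
  states.\<close>

lemma stoch_increasing_tails:
  assumes "stoch_increasing X U P" "u \<in> {1..U}" "l \<in> {1..X}"
  shows "mono_on {1..X} (\<lambda>i. \<Sum>j=l..X. pmf (P i u) j)"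
proof (rule mono_onI)
  fix i i' assume "i \<in> {1..X}" "i' \<in> {1..X}" "i \<le> i'"
  from \<open>i \<le> i'\<close> this(1,2) show "(\<Sum>j=l..X. pmf (P i u) j) \<le> (\<Sum>j=l..X. pmf (P i' u) j)"
  proof (induction i' rule: dec_induct)
    case (step n)
    have "(\<Sum>j=l..X. pmf (P n u) j) \<le> (\<Sum>j=l..X. pmf (P (Suc n) u) j)"
      using assms step by (auto simp: stoch_increasing_def stoch_dom_le_def)
    with step show ?case by auto
  qed simp
qed

lemma antimono_on_action_value:
  assumes X: "1 \<le> X" and P: "transitions_within X U P" and c: "decreasing_cost X U c"
    and inc: "stoch_increasing X U P" and V: "antimono_on {1..X} V" and u: "u \<in> {1..U}"
  shows "antimono_on {1..X} (\<lambda>i. action_value X c P V i u)"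
proof (rule monotone_onI)
  fix i j assume ij: "i \<in> {1..X}" "j \<in> {1..X}" "i \<le> j"
  have "(\<Sum>l=1..X. pmf (P j u) l * V l) \<le> (\<Sum>l=1..X. pmf (P i u) l * V l)"
    using ij u sum_pmf_row[OF P] monotone_onD[OF stoch_increasing_tails[OF inc u] ij]
    by (intro sum_mult_antimono_le[OF X V]) metis+
  moreover have "c j u \<le> c i u"
    using c u ij by (auto simp: decreasing_cost_def monotone_on_def)
  ultimately show "action_value X c P V j u \<le> action_value X c P V i u"
    by (simp add: action_value_def)
qed

text \<open>The future part of the difference is \<open>V\<close> summed against the difference of
  two rows. These differences have total 0 and tails that increase in the state, and a decreasing
  \<open>V\<close> reverses the order.\<close>

lemma submodular_action_value:
  assumes X: "1 \<le> X" and P: "transitions_within X U P" and c: "submodular_cost X U c"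
    and super: "tail_sum_supermodular X U P" and V: "antimono_on {1..X} V" and u: "u \<in> {1..<U}"
  shows "antimono_on {1..X} (\<lambda>i. action_value X c P V i (u + 1) - action_value X c P V i u)"
proof (rule monotone_onI)
  fix i j assume ij: "i \<in> {1..X}" "j \<in> {1..X}" "i \<le> j"
  let ?d = "\<lambda>i l. pmf (P i (u + 1)) l - pmf (P i u) l"
  have "(\<Sum>l=1..X. ?d j l * V l) \<le> (\<Sum>l=1..X. ?d i l * V l)"
  proof (rule sum_mult_antimono_le[OF X V])
    show "(\<Sum>l=1..X. ?d i l) = (\<Sum>l=1..X. ?d j l)"
      unfolding sum_subtractf using ij u by (subst (1 2 3 4) sum_pmf_row[OF P]) auto
    show "(\<Sum>l=m..X. ?d i l) \<le> (\<Sum>l=m..X. ?d j l)" if "m \<in> {1..X}" for m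
      using super u that ij unfolding tail_sum_supermodular_def monotone_on_def by blast
  qed
  moreover have "c j (u + 1) - c j u \<le> c i (u + 1) - c i u"
    using c u ij unfolding submodular_cost_def monotone_on_def by blast
  ultimately show "action_value X c P V j (u + 1) - action_value X c P V j u
      \<le> action_value X c P V i (u + 1) - action_value X c P V i u"
    by (simp add: action_value_def sum_subtractf algebra_simps)
qed

section \<open>Bellman fixed point of the discounted problem\<close>

lemma abs_state_value_diff_le:
  assumes U: "1 \<le> U" and "\<And>u. u \<in> {1..U} \<Longrightarrow> \<bar>Q i u - R i u\<bar> \<le> d"
  shows "\<bar>state_value U Q i - state_value U R i\<bar> \<le> d"
proof -
  have "state_value U Q i - d \<le> state_value U R i" "state_value U R i - d \<le> state_value U Q i"
    unfolding le_state_value_iff[OF U]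
    using state_value_le[of _ U Q i] state_value_le[of _ U R i] assms(2) by (auto simp: abs_le_iff; fastforce)+
  then show ?thesis by linarith
qed

text \<open>Averaging against a probability row does not enlarge distances. Together with the same
  property of minima this makes the discounted operator a contraction.\<close>

lemma abs_action_value_diff_le:
  assumes P: "transitions_within X U P" and i: "i \<in> {1..X}" and u: "u \<in> {1..U}"
    and d: "\<And>j. j \<in> {1..X} \<Longrightarrow> \<bar>V j - W j\<bar> \<le> d"
  shows "\<bar>action_value X c P V i u - action_value X c P W i u\<bar> \<le> d"
proof -
  have "\<bar>action_value X c P V i u - action_value X c P W i u\<bar> = \<bar>\<Sum>j=1..X. pmf (P i u) j * (V j - W j)\<bar>"
    by (simp add: action_value_def sum_subtractf algebra_simps)
  also have "\<dots> \<le> (\<Sum>j=1..X. \<bar>pmf (P i u) j * (V j - W j)\<bar>)"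
    by (rule sum_abs)
  also have "\<dots> \<le> (\<Sum>j=1..X. pmf (P i u) j * d)"
    using d by (intro sum_mono) (auto simp: abs_mult intro!: mult_left_mono)
  also have "\<dots> = d"
    using sum_pmf_row[OF P i u] by (simp flip: sum_distrib_right)
  finally show ?thesis .
qed

text \<open>The discount factor is placed on the value function, so that the undiscounted operator
  of the finite horizon serves here as well.\<close>

definition bellman_fixpoint ::
  "nat \<Rightarrow> nat \<Rightarrow> (nat \<Rightarrow> nat \<Rightarrow> nat pmf) \<Rightarrow> (nat \<Rightarrow> nat \<Rightarrow> real) \<Rightarrow> real \<Rightarrow> (nat \<Rightarrow> real) \<Rightarrow> bool"
where
  "bellman_fixpoint X U P c \<rho> V \<longleftrightarrow>
     (\<forall>i\<in>{1..X}. V i = state_value U (action_value X c P (\<lambda>j. \<rho> * V j)) i)"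

text \<open>Value iteration from 0: each step preserves being decreasing and contracts by the factor
  \<open>\<rho>\<close>, so the increments decay geometrically, the iterates converge at each state,
  and the limit is a decreasing fixed point.\<close>

lemma bellman_fixpoint_exists:
  assumes X: "1 \<le> X" and U: "1 \<le> U" and P: "transitions_within X U P" and c: "decreasing_cost X U c"
    and inc: "stoch_increasing X U P" and \<rho>: "0 \<le> \<rho>" "\<rho> < 1"
  obtains V where "antimono_on {1..X} V" "bellman_fixpoint X U P c \<rho> V"
proof -
  define T where "T V = state_value U (action_value X c P (\<lambda>j. \<rho> * V j))" for V
  have contraction: "\<bar>T V i - T W i\<bar> \<le> \<rho> * d"
    if "\<And>j. j \<in> {1..X} \<Longrightarrow> \<bar>V j - W j\<bar> \<le> d" "i \<in> {1..X}" for V W i d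
    unfolding T_def using that \<rho>
    by (intro abs_state_value_diff_le[OF U] abs_action_value_diff_le[OF P])
       (auto simp: abs_mult mult_left_mono simp flip: right_diff_distrib)
  define v where "v n = (T ^^ n) (\<lambda>_. 0)" for n
  have v_Suc: "v (Suc n) = T (v n)" for n
    by (simp add: v_def)
  have anti: "antimono_on {1..X} (v n)" for n
  proof (induction n)
    case 0
    show ?case by (simp add: v_def monotone_on_def)
  next
    case (Suc n)
    then have "antimono_on {1..X} (\<lambda>j. \<rho> * v n j)"
      using \<rho> by (auto simp: monotone_on_def intro!: mult_left_mono)
    then show ?case
      unfolding v_Suc T_def
      by (intro antimono_on_state_value[OF U] antimono_on_action_value[OF X P c inc])
  qed
  \<comment> \<open>The sum of the absolute values stands in for the maximum norm: it dominates
    every coordinate.\<close>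
  define B where "B = (\<Sum>i=1..X. \<bar>v 1 i - v 0 i\<bar>)"
  have geometric: "\<bar>v (Suc n) i - v n i\<bar> \<le> B * \<rho> ^ n" if "i \<in> {1..X}" for n i
    using that
  proof (induction n arbitrary: i)
    case 0
    then show ?case
      unfolding B_def by (simp, intro member_le_sum) auto
  next
    case (Suc n)
    then have "\<bar>T (v (Suc n)) i - T (v n) i\<bar> \<le> \<rho> * (B * \<rho> ^ n)"
      by (intro contraction)
    then show ?case
      by (simp add: v_Suc mult_ac)
  qed
  have "convergent (\<lambda>n. v n i)" if i: "i \<in> {1..X}" for i
  proof -
    have "summable (\<lambda>n. v (Suc n) i - v n i)"
      by (rule summable_comparison_test'[where g = "\<lambda>n. B * \<rho> ^ n" and N = 0])
         (use geometric[OF i] \<rho> in \<open>auto intro!: summable_mult summable_geometric\<close>)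
    then have "convergent (\<lambda>n. v n i - v 0 i)"
      by (simp add: summable_iff_convergent sum_lessThan_telescope[of "\<lambda>n. v n i"])
    then have "convergent (\<lambda>n. (v n i - v 0 i) + v 0 i)"
      by (intro convergent_add convergent_const)
    then show ?thesis by simp
  qed
  then obtain V where lim: "\<And>i. i \<in> {1..X} \<Longrightarrow> (\<lambda>n. v n i) \<longlonglongrightarrow> V i"
    unfolding convergent_def by metis
  have TV: "V i = T V i" if i: "i \<in> {1..X}" for i
  proof (rule LIMSEQ_unique)
    show "(\<lambda>n. v (Suc n) i) \<longlonglongrightarrow> V i"
      using lim[OF i] by (rule LIMSEQ_Suc)
    \<comment> \<open>The summed distance from \<open>v n\<close> to \<open>V\<close> tends to 0,
      and the contraction transfers this to \<open>v (Suc n)\<close> and \<open>T V\<close>.\<close>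
    have "(\<lambda>n. \<rho> * (\<Sum>j=1..X. \<bar>v n j - V j\<bar>)) \<longlonglongrightarrow> \<rho> * (\<Sum>j=1..X. \<bar>V j - V j\<bar>)"
      using lim by (intro tendsto_intros) auto
    then have "(\<lambda>n. \<rho> * (\<Sum>j=1..X. \<bar>v n j - V j\<bar>)) \<longlonglongrightarrow> 0"
      by simp
    moreover have "\<bar>v (Suc n) i - T V i\<bar> \<le> \<rho> * (\<Sum>j=1..X. \<bar>v n j - V j\<bar>)" for n
      unfolding v_Suc using i by (intro contraction member_le_sum) auto
    ultimately have "(\<lambda>n. v (Suc n) i - T V i) \<longlonglongrightarrow> 0"
      by (intro Lim_null_comparison[of "\<lambda>n. v (Suc n) i - T V i"]) auto
    then show "(\<lambda>n. v (Suc n) i) \<longlonglongrightarrow> T V i"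
      by (simp add: LIM_zero_iff)
  qed
  show thesis
  proof
    show "antimono_on {1..X} V"
      using anti by (intro monotone_onI) (auto intro!: LIMSEQ_le[OF lim lim] simp: monotone_on_def)
    show "bellman_fixpoint X U P c \<rho> V"
      using TV by (auto simp: bellman_fixpoint_def T_def)
  qed
qed

subsection \<open>Controlled chains and verification inequalities\<close>

text \<open>\<open>T\<close> holds the decision times: \<open>{..<N}\<close> for a finite horizon,
  \<open>UNIV\<close> for an infinite one. A premise \<open>{..<n} \<subseteq> T\<close> says that
  the first \<open>n\<close> transitions stay among the states.\<close>

locale controlled_chain =
  fixes X :: nat and T :: "nat set" and P :: "nat \<Rightarrow> nat \<Rightarrow> nat \<Rightarrow> nat pmf"
    and \<mu> :: "nat \<Rightarrow> nat \<Rightarrow> nat" and x0 :: nat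
  assumes initial: "x0 \<in> {1..X}"
    and row: "\<And>k i. k \<in> T \<Longrightarrow> i \<in> {1..X} \<Longrightarrow> set_pmf (P k i (\<mu> k i)) \<subseteq> {1..X}"
begin

definition expect :: "nat \<Rightarrow> (nat \<Rightarrow> real) \<Rightarrow> real" where
  "expect n f = measure_pmf.expectation (state_pmf P \<mu> x0 n) f"

lemma expect_0 [simp]: "expect 0 f = f x0"
  by (simp add: expect_def)

lemma state_within: "{..<n} \<subseteq> T \<Longrightarrow> set_pmf (state_pmf P \<mu> x0 n) \<subseteq> {1..X}"
  using initial row by (intro set_state_pmf) auto

lemma expect_eq_sum:
  "{..<n} \<subseteq> T \<Longrightarrow> expect n f = (\<Sum>i=1..X. pmf (state_pmf P \<mu> x0 n) i * f i)"
  unfolding expect_def using state_within[of n] by (subst integral_measure_pmf[of "{1..X}"]) auto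

lemma expect_add: "{..<n} \<subseteq> T \<Longrightarrow> expect n (\<lambda>i. f i + g i) = expect n f + expect n g"
  by (simp add: expect_eq_sum distrib_left sum.distrib)

lemma expect_cmult: "expect n (\<lambda>i. a * f i) = a * expect n f"
  by (simp add: expect_def)

lemma expect_uminus: "expect n (\<lambda>i. - f i) = - expect n f"
  by (simp add: expect_def)

lemma expect_const: "expect n (\<lambda>i. a) = a"
  by (simp add: expect_def)

lemma expect_mono:
  "{..<n} \<subseteq> T \<Longrightarrow> (\<And>i. i \<in> {1..X} \<Longrightarrow> f i \<le> g i) \<Longrightarrow> expect n f \<le> expect n g"
  by (auto simp: expect_eq_sum intro!: sum_mono mult_left_mono)

lemma abs_expect_le:
  assumes "{..<n} \<subseteq> T" and "\<And>i. i \<in> {1..X} \<Longrightarrow> \<bar>f i\<bar> \<le> B"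
  shows "\<bar>expect n f\<bar> \<le> B"
proof -
  have "expect n f \<le> expect n (\<lambda>_. B)" "expect n (\<lambda>_. - B) \<le> expect n f"
    using assms by (intro expect_mono; force simp: abs_le_iff)+
  then show ?thesis
    by (simp add: expect_const)
qed

lemma expect_Suc:
  assumes "{..<Suc n} \<subseteq> T"
  shows "expect (Suc n) f = expect n (\<lambda>i. \<Sum>j=1..X. pmf (P n i (\<mu> n i)) j * f j)"
proof -
  have T: "{..<n} \<subseteq> T" "n \<in> T"
    using assms by auto
  have "expect (Suc n) f =
    (\<Sum>i=1..X. pmf (state_pmf P \<mu> x0 n) i * measure_pmf.expectation (P n i (\<mu> n i)) f)"
    unfolding expect_def state_pmf.simps
    using state_within[OF T(1)] row[OF T(2)]
    by (subst pmf_expectation_bind[of "{1..X}"]) (auto intro: finite_subset)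
  also have "\<dots> = (\<Sum>i=1..X. pmf (state_pmf P \<mu> x0 n) i * (\<Sum>j=1..X. pmf (P n i (\<mu> n i)) j * f j))"
  proof (intro sum.cong refl arg_cong2[where f = "(*)"])
    fix i assume "i \<in> {1..X}"
    then show "measure_pmf.expectation (P n i (\<mu> n i)) f = (\<Sum>j=1..X. pmf (P n i (\<mu> n i)) j * f j)"
      using row[OF T(2), of i] by (subst integral_measure_pmf[of "{1..X}"]) auto
  qed
  finally show ?thesis
    using T by (simp add: expect_eq_sum)
qed

text \<open>This turns a pointwise Bellman inequality at time \<open>n\<close> into a relation
  between expectations at times \<open>n\<close> and \<open>Suc n\<close>.\<close>

lemma expect_action_value:
  assumes "{..<Suc n} \<subseteq> T"
  shows "expect n (\<lambda>i. action_value X c (P n) f i (\<mu> n i)) =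
    expect n (\<lambda>i. c i (\<mu> n i)) + expect (Suc n) f"
  unfolding expect_Suc[OF assms] action_value_def using assms by (intro expect_add) auto

text \<open>Taking expectations in the Bellman inequality, scaling by \<open>\<rho> ^ k\<close> and
  chaining over \<open>k\<close> telescopes the values \<open>W\<close>. Time-dependent
  \<open>W\<close> with discount 1 serves the finite horizon, constant \<open>W\<close> the
  discounted problem.\<close>

lemma discounted_lower_bound:
  assumes "{..<n} \<subseteq> T" and \<rho>: "0 \<le> \<rho>"
    and W: "\<And>k i. k < n \<Longrightarrow> i \<in> {1..X} \<Longrightarrow>
      W k i \<le> action_value X (c k) (P k) (\<lambda>j. \<rho> * W (Suc k) j) i (\<mu> k i)"
  shows "W 0 x0 \<le> (\<Sum>k<n. \<rho> ^ k * expect k (\<lambda>i. c k i (\<mu> k i))) + \<rho> ^ n * expect n (W n)"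
  using assms(1) W
proof (induction n)
  case (Suc n)
  have "expect n (W n) \<le> expect n (\<lambda>i. action_value X (c n) (P n) (\<lambda>j. \<rho> * W (Suc n) j) i (\<mu> n i))"
    using Suc.prems by (intro expect_mono) auto
  also have "\<dots> = expect n (\<lambda>i. c n i (\<mu> n i)) + \<rho> * expect (Suc n) (W (Suc n))"
    using Suc.prems by (simp add: expect_action_value expect_cmult)
  finally have "\<rho> ^ n * expect n (W n) \<le>
    \<rho> ^ n * (expect n (\<lambda>i. c n i (\<mu> n i)) + \<rho> * expect (Suc n) (W (Suc n)))"
    using \<rho> by (intro mult_left_mono) auto
  moreover have "W 0 x0 \<le> (\<Sum>k<n. \<rho> ^ k * expect k (\<lambda>i. c k i (\<mu> k i))) + \<rho> ^ n * expect n (W n)"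
    using Suc.prems by (intro Suc.IH) auto
  ultimately show ?case
    by (simp add: algebra_simps)
qed simp

text \<open>Changing the signs of costs and values exchanges the two Bellman inequalities, so each
  upper bound below follows from its lower counterpart.\<close>

lemma action_value_uminus:
  "action_value X (\<lambda>i u. - c i u) Q (\<lambda>j. - V j) i u = - action_value X c Q V i u"
  by (simp add: action_value_def sum_negf)

lemma discounted_upper_bound:
  assumes "{..<n} \<subseteq> T" and "0 \<le> \<rho>"
    and "\<And>k i. k < n \<Longrightarrow> i \<in> {1..X} \<Longrightarrow>
      action_value X (c k) (P k) (\<lambda>j. \<rho> * W (Suc k) j) i (\<mu> k i) \<le> W k i"
  shows "(\<Sum>k<n. \<rho> ^ k * expect k (\<lambda>i. c k i (\<mu> k i))) + \<rho> ^ n * expect n (W n) \<le> W 0 x0"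
  using discounted_lower_bound[of n \<rho> "\<lambda>k i. - W k i" "\<lambda>k i u. - c k i u"] assms
  by (simp add: action_value_uminus expect_uminus sum_negf)

text \<open>
  Splitting \<open>V - \<rho> P V\<close> as \<open>(V - P V) + (1 - \<rho>) P V\<close>, the first part telescopes and the second is
  close to \<open>P g\<close>.
\<close>

lemma total_lower_bound:
  assumes "{..<n} \<subseteq> T"
    and V: "\<And>k i. k < n \<Longrightarrow> i \<in> {1..X} \<Longrightarrow> V i \<le> action_value X c (P k) (\<lambda>j. \<rho> * V j) i (\<mu> k i)"
    and g: "\<And>k i. k < n \<Longrightarrow> i \<in> {1..X} \<Longrightarrow> g i \<le> (\<Sum>j=1..X. pmf (P k i (\<mu> k i)) j * g j)"
    and close: "\<And>i. i \<in> {1..X} \<Longrightarrow> g i - \<delta> \<le> (1 - \<rho>) * V i"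
    and B: "\<And>i. i \<in> {1..X} \<Longrightarrow> \<bar>V i\<bar> \<le> B"
  shows "real n * (g x0 - \<delta>) - 2 * B \<le> (\<Sum>k<n. expect k (\<lambda>i. c i (\<mu> k i)))"
proof -
  \<comment> \<open>The second conjunct is carried through the induction because each new step
    contributes at least \<open>expect (Suc n) g - \<delta>\<close>, which has to be compared with
    \<open>g x0 - \<delta>\<close>.\<close>
  have "real n * (g x0 - \<delta>) + V x0 - expect n V \<le> (\<Sum>k<n. expect k (\<lambda>i. c i (\<mu> k i))) \<and>
    g x0 \<le> expect n g"
    using assms(1) V g
  proof (induction n)
    case (Suc n)
    have sub: "{..<n} \<subseteq> T"
      using Suc.prems by auto
    have "expect n V \<le> expect n (\<lambda>i. action_value X c (P n) (\<lambda>j. \<rho> * V j) i (\<mu> n i))"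
      using Suc.prems by (intro expect_mono sub) auto
    then have 1: "expect n V \<le> expect n (\<lambda>i. c i (\<mu> n i)) + \<rho> * expect (Suc n) V"
      using Suc.prems by (simp add: expect_action_value expect_cmult)
    have "expect n g \<le> expect n (\<lambda>i. \<Sum>j=1..X. pmf (P n i (\<mu> n i)) j * g j)"
      using Suc.prems by (intro expect_mono sub) auto
    then have 2: "expect n g \<le> expect (Suc n) g"
      using Suc.prems by (simp add: expect_Suc)
    have "expect (Suc n) (\<lambda>i. g i + - \<delta>) \<le> expect (Suc n) (\<lambda>i. (1 - \<rho>) * V i)"
      using Suc.prems close by (intro expect_mono) auto
    then have 3: "expect (Suc n) g - \<delta> \<le> (1 - \<rho>) * expect (Suc n) V"
      using Suc.prems by (simp only: expect_add expect_const expect_cmult)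
    have "real n * (g x0 - \<delta>) + V x0 - expect n V \<le> (\<Sum>k<n. expect k (\<lambda>i. c i (\<mu> k i))) \<and>
        g x0 \<le> expect n g"
      using Suc.prems by (intro Suc.IH) auto
    with 1 2 3 show ?case
      by (simp add: algebra_simps)
  qed simp
  \<comment> \<open>Only the two ends of the telescoped sum remain; they cost at most
    \<open>2 * B\<close>, whatever \<open>n\<close> is.\<close>
  moreover have "\<bar>V x0\<bar> \<le> B" "\<bar>expect n V\<bar> \<le> B"
    using B initial assms(1) by (auto intro!: abs_expect_le)
  ultimately show ?thesis
    by linarith
qed

lemma total_upper_bound:
  assumes "{..<n} \<subseteq> T"
    and "\<And>k i. k < n \<Longrightarrow> i \<in> {1..X} \<Longrightarrow> action_value X c (P k) (\<lambda>j. \<rho> * V j) i (\<mu> k i) \<le> V i"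
    and "\<And>k i. k < n \<Longrightarrow> i \<in> {1..X} \<Longrightarrow> (\<Sum>j=1..X. pmf (P k i (\<mu> k i)) j * g j) \<le> g i"
    and "\<And>i. i \<in> {1..X} \<Longrightarrow> (1 - \<rho>) * V i \<le> g i + \<delta>"
    and "\<And>i. i \<in> {1..X} \<Longrightarrow> \<bar>V i\<bar> \<le> B"
  shows "(\<Sum>k<n. expect k (\<lambda>i. c i (\<mu> k i))) \<le> real n * (g x0 + \<delta>) + 2 * B"
proof -
  have "- g i - \<delta> \<le> (1 - \<rho>) * - V i" if "i \<in> {1..X}" for i
    using assms(4)[OF that] by simp
  then have "real n * (- g x0 - \<delta>) - 2 * B \<le> (\<Sum>k<n. expect k (\<lambda>i. - c i (\<mu> k i)))"
    using assms by (intro total_lower_bound[of n "\<lambda>i. - V i" "\<lambda>i u. - c i u" \<rho> "\<lambda>i. - g i"])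
      (auto simp: action_value_uminus sum_negf)
  then show ?thesis
    by (simp add: expect_uminus sum_negf algebra_simps)
qed

section \<open>Costs as sums of expectations\<close>

lemma integral_component: "(\<integral>\<omega>. f (\<omega> n) \<partial>trajectory_law P \<mu> x0) = expect n f"
  unfolding expect_def by (rule trajectory_integral)

lemma integrable_component:
  fixes f :: "nat \<Rightarrow> real"
  assumes "{..<n} \<subseteq> T"
  shows "integrable (trajectory_law P \<mu> x0) (\<lambda>\<omega>. f (\<omega> n))"
proof -
  have "integrable (distr (trajectory_law P \<mu> x0) (count_space UNIV) (\<lambda>\<omega>. \<omega> n)) f"
    unfolding distr_trajectory_law
    using state_within[OF assms] by (intro integrable_measure_pmf_finite) (auto intro: finite_subset)
  then show ?thesis
    by (subst (asm) integrable_distr_eq) auto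
qed

lemma AE_component:
  assumes "{..<n} \<subseteq> T"
  shows "AE \<omega> in trajectory_law P \<mu> x0. \<omega> n \<in> {1..X}"
proof -
  have "AE i in distr (trajectory_law P \<mu> x0) (count_space UNIV) (\<lambda>\<omega>. \<omega> n). i \<in> {1..X}"
    unfolding distr_trajectory_law using state_within[OF assms] by (auto simp: AE_measure_pmf_iff)
  then show ?thesis
    by (subst (asm) AE_distr_iff) auto
qed

lemma integral_total:
  fixes f :: "nat \<Rightarrow> nat \<Rightarrow> real"
  assumes "{..<n} \<subseteq> T"
  shows "(\<integral>\<omega>. (\<Sum>k<n. f k (\<omega> k)) \<partial>trajectory_law P \<mu> x0) = (\<Sum>k<n. expect k (f k))"
proof -
  have "integrable (trajectory_law P \<mu> x0) (\<lambda>\<omega>. f k (\<omega> k))" if "k \<in> {..<n}" for k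
    using assms that by (intro integrable_component) auto
  then have "(\<integral>\<omega>. (\<Sum>k<n. f k (\<omega> k)) \<partial>trajectory_law P \<mu> x0) =
      (\<Sum>k<n. \<integral>\<omega>. f k (\<omega> k) \<partial>trajectory_law P \<mu> x0)"
    by (rule Bochner_Integration.integral_sum)
  then show ?thesis
    by (simp add: integral_component)
qed

lemma finite_horizon_cost_eq:
  assumes "{..<N} \<subseteq> T"
  shows "finite_horizon_cost N P c cN \<mu> x0 =
    (\<Sum>k<N. expect k (\<lambda>i. c k i (\<mu> k i))) + expect N cN"
proof -
  have "integrable (trajectory_law P \<mu> x0) (\<lambda>\<omega>. c k (\<omega> k) (\<mu> k (\<omega> k)))" if "k \<in> {..<N}" for k
    using assms that by (intro integrable_component[of k "\<lambda>i. c k i (\<mu> k i)"]) auto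
  then have "integrable (trajectory_law P \<mu> x0) (\<lambda>\<omega>. \<Sum>k<N. c k (\<omega> k) (\<mu> k (\<omega> k)))"
    by (rule Bochner_Integration.integrable_sum)
  then have "finite_horizon_cost N P c cN \<mu> x0 =
      (\<integral>\<omega>. (\<Sum>k<N. c k (\<omega> k) (\<mu> k (\<omega> k))) \<partial>trajectory_law P \<mu> x0) +
      (\<integral>\<omega>. cN (\<omega> N) \<partial>trajectory_law P \<mu> x0)"
    unfolding finite_horizon_cost_def
    by (rule Bochner_Integration.integral_add) (rule integrable_component[OF assms])
  then show ?thesis
    using integral_total[OF assms, of "\<lambda>k i. c k i (\<mu> k i)"] by (simp add: integral_component)
qed

text \<open>Series and integral are interchanged by absolute convergence: the terms are almost
  surely dominated by the geometric sequence \<open>\<rho> ^ k * B\<close>.\<close>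

lemma integral_discounted_sum:
  fixes f :: "nat \<Rightarrow> nat \<Rightarrow> real"
  assumes T: "T = UNIV" and \<rho>: "0 \<le> \<rho>" "\<rho> < 1"
    and bound: "\<And>k i. i \<in> {1..X} \<Longrightarrow> \<bar>f k i\<bar> \<le> B"
  shows "(\<lambda>k. \<rho> ^ k * expect k (f k)) sums (\<integral>\<omega>. (\<Sum>k. \<rho> ^ k * f k (\<omega> k)) \<partial>trajectory_law P \<mu> x0)"
proof -
  let ?L = "trajectory_law P \<mu> x0"
  have abs_f: "\<bar>\<rho> ^ k * f k i\<bar> \<le> \<rho> ^ k * B" if "i \<in> {1..X}" for k i
    using bound[OF that] \<rho> by (simp add: abs_mult mult_left_mono)
  have geo: "summable (\<lambda>k. \<rho> ^ k * B)"
    using \<rho> by (intro summable_mult2 summable_geometric) auto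
  \<comment> \<open>The bound on \<open>f\<close> holds on the states only, so one null set must
    serve all times at once; countably many times allow this.\<close>
  have "AE \<omega> in ?L. \<forall>k. \<omega> k \<in> {1..X}"
    unfolding AE_all_countable by (intro allI AE_component) (simp add: T)
  then have AE: "AE \<omega> in ?L. summable (\<lambda>k. norm (\<rho> ^ k * f k (\<omega> k)))"
  proof eventually_elim
    case (elim \<omega>)
    then show ?case
      by (intro summable_comparison_test'[OF geo, of 0]) (auto simp: abs_f)
  qed
  have int: "integrable ?L (\<lambda>\<omega>. \<rho> ^ k * f k (\<omega> k))" for k
    by (rule integrable_component[of k "\<lambda>i. \<rho> ^ k * f k i"]) (simp add: T)
  have norms: "summable (\<lambda>k. \<integral>\<omega>. norm (\<rho> ^ k * f k (\<omega> k)) \<partial>?L)"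
  proof (rule summable_comparison_test'[OF geo, of 0])
    fix k
    have "(\<integral>\<omega>. norm (\<rho> ^ k * f k (\<omega> k)) \<partial>?L) = expect k (\<lambda>i. norm (\<rho> ^ k * f k i))"
      by (rule integral_component)
    then show "norm (\<integral>\<omega>. norm (\<rho> ^ k * f k (\<omega> k)) \<partial>?L) \<le> \<rho> ^ k * B"
      using abs_f by (auto simp: T intro!: abs_expect_le)
  qed
  have component: "(\<integral>\<omega>. \<rho> ^ k * f k (\<omega> k) \<partial>?L) = \<rho> ^ k * expect k (f k)" for k
    using integral_component[of "\<lambda>i. \<rho> ^ k * f k i" k] by (simp only: expect_cmult)
  have "summable (\<lambda>k. \<rho> ^ k * expect k (f k))"
    using summable_integral[OF int AE norms] unfolding component .
  then show ?thesis
    unfolding integral_suminf[OF int AE norms] component by (rule summable_sums)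
qed

end

subsection \<open>Optimal monotone policies\<close>

lemma controlled_chain_policy:
  assumes "\<And>k. k \<in> T \<Longrightarrow> transitions_within X U (P k)" and "\<mu> \<in> policies T X U" and "x0 \<in> {1..X}"
  shows "controlled_chain X T P \<mu> x0"
proof
  fix k i assume "k \<in> T" "i \<in> {1..X}"
  moreover from this have "\<mu> k i \<in> {1..U}"
    using assms(2) by (fastforce simp: policies_def)
  ultimately show "set_pmf (P k i (\<mu> k i)) \<subseteq> {1..X}"
    using assms(1) unfolding transitions_within_def by blast
qed fact

lemma policies_D: "\<mu> \<in> policies T X U \<Longrightarrow> k \<in> T \<Longrightarrow> i \<in> {1..X} \<Longrightarrow> \<mu> k i \<in> {1..U}"
  unfolding policies_def by (fastforce simp: Pi_iff)

section \<open>Finite horizon\<close>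

lemma bellman_Q_eq:
  "bellman_Q X U N P c cN k = action_value X (c k) (P k) (bellman_J X U N P c cN (Suc k))"
  by (intro ext) (simp add: bellman_Q_def action_value_def)

lemma bellman_J_eq:
  "bellman_J X U N P c cN k = (if k < N then state_value U (bellman_Q X U N P c cN k) else cN)"
  by (intro ext, subst bellman_J.simps) (simp add: state_value_def bellman_Q_def)

text \<open>The value functions are decreasing by induction backwards from \<open>N\<close>, which
  makes the greedy policy monotone. It is optimal because \<open>J 0\<close> bounds its cost from
  above and that of every other policy from below.\<close>

lemma finite_horizon_monotone_policy:
  assumes X: "1 \<le> X" and U: "1 \<le> U"
    and P: "\<And>k. k < N \<Longrightarrow> transitions_within X U (P k)"
    and c: "\<And>k. k < N \<Longrightarrow> decreasing_cost X U (c k)" and cN: "antimono_on {1..X} cN"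
    and inc: "\<And>k. k < N \<Longrightarrow> stoch_increasing X U (P k)"
    and sub: "\<And>k. k < N \<Longrightarrow> submodular_cost X U (c k)"
    and super: "\<And>k. k < N \<Longrightarrow> tail_sum_supermodular X U (P k)"
  shows "\<exists>\<mu>. optimal_policy X (policies {..<N} X U) (finite_horizon_cost N P c cN) \<mu> \<and>
    bellman_policy X U N P c cN \<mu> \<and> (\<forall>k<N. mono_on {1..X} (\<mu> k))"
proof -
  define J where "J = bellman_J X U N P c cN"
  define Q where "Q = bellman_Q X U N P c cN"
  have Q: "Q k = action_value X (c k) (P k) (J (Suc k))" for k
    unfolding J_def Q_def by (rule bellman_Q_eq)
  have J: "J k = (if k < N then state_value U (Q k) else cN)" for k
    unfolding J_def Q_def by (rule bellman_J_eq)
  have antimono_J: "antimono_on {1..X} (J k)" if "k \<le> N" for k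
    using that
  proof (induction k rule: inc_induct)
    case (step k)
    have "antimono_on {1..X} (state_value U (Q k))"
      unfolding Q using step
      by (intro antimono_on_state_value[OF U] antimono_on_action_value[OF X P c inc])
    with step show ?case
      by (simp add: J[of k])
  qed (use cN in \<open>simp add: J\<close>)
  define \<mu> where "\<mu> k = greedy U (Q k)" for k
  have \<mu>_in: "\<mu> \<in> policies {..<N} X U"
    using greedy_in[OF U] by (auto simp: policies_def \<mu>_def)
  have mono: "mono_on {1..X} (\<mu> k)" if "k < N" for k
    unfolding \<mu>_def Q using that
    by (intro mono_on_greedy[OF U] submodular_action_value[OF X P sub super] antimono_J) auto
  have "bellman_policy X U N P c cN \<mu>"
    using state_value_le[of _ U] greedy_in[OF U] greedy_value[OF U]
    unfolding bellman_policy_def is_arg_min_linorder Q_def[symmetric] \<mu>_def by metis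
  moreover have "optimal_policy X (policies {..<N} X U) (finite_horizon_cost N P c cN) \<mu>"
    unfolding optimal_policy_def
  proof (intro conjI ballI \<mu>_in)
    fix \<nu> x0 assume \<nu>: "\<nu> \<in> policies {..<N} X U" and x0: "x0 \<in> {1..X}"
    interpret opt: controlled_chain X "{..<N}" P \<mu> x0
      by (rule controlled_chain_policy[OF P \<mu>_in x0]) auto
    interpret alt: controlled_chain X "{..<N}" P \<nu> x0
      by (rule controlled_chain_policy[OF P \<nu> x0]) auto
    \<comment> \<open>The discount factor is 1 here. At time \<open>N\<close> the values equal
      \<open>cN\<close>, so the remainder in the bound is exactly the expected terminal
      cost.\<close>
    have "finite_horizon_cost N P c cN \<mu> x0 \<le> J 0 x0"
      using opt.discounted_upper_bound[of N 1 c J] greedy_value[OF U]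
      by (simp add: opt.finite_horizon_cost_eq flip: Q) (simp add: J \<mu>_def)
    also have "\<dots> \<le> finite_horizon_cost N P c cN \<nu> x0"
      using alt.discounted_lower_bound[of N 1 J c] policies_D[OF \<nu>] state_value_le[of _ U]
      by (simp add: alt.finite_horizon_cost_eq flip: Q) (simp add: J)
    finally show "finite_horizon_cost N P c cN \<mu> x0 \<le> finite_horizon_cost N P c cN \<nu> x0" .
  qed
  ultimately show ?thesis
    using mono by blast
qed

section \<open>Discounted cost\<close>

lemma abs_bounded_on_finite:
  fixes f :: "'a \<Rightarrow> real"
  assumes "finite A"
  shows "\<exists>C. \<forall>x\<in>A. \<bar>f x\<bar> \<le> C"
  using assms by (intro exI[of _ "\<Sum>x\<in>A. \<bar>f x\<bar>"] ballI member_le_sum) auto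

lemma bellman_fixpointD:
  assumes "bellman_fixpoint X U P c \<rho> V" "i \<in> {1..X}"
  shows bellman_fixpoint_le:
      "u \<in> {1..U} \<Longrightarrow> V i \<le> action_value X c P (\<lambda>j. \<rho> * V j) i u"
    and bellman_fixpoint_greedy: "1 \<le> U \<Longrightarrow>
      V i = action_value X c P (\<lambda>j. \<rho> * V j) i (greedy U (action_value X c P (\<lambda>j. \<rho> * V j)) i)"
  using assms state_value_le[of u U] greedy_value[of U] by (auto simp: bellman_fixpoint_def)

text \<open>Both bounds arise from their versions with \<open>n\<close> steps as \<open>n\<close>
  grows: \<open>V\<close> is bounded on the finitely many states, so the remainder
  \<open>\<rho> ^ n * expect n V\<close> vanishes.\<close>

lemma discounted_cost_bounds:
  assumes P: "transitions_within X U P" and \<nu>: "\<nu> \<in> policies UNIV X U" and x0: "x0 \<in> {1..X}"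
    and \<rho>: "0 \<le> \<rho>" "\<rho> < 1"
  shows discounted_cost_ge:
      "(\<And>k i. i \<in> {1..X} \<Longrightarrow> V i \<le> action_value X c P (\<lambda>j. \<rho> * V j) i (\<nu> k i)) \<Longrightarrow>
        V x0 \<le> discounted_cost \<rho> P c \<nu> x0"
    and discounted_cost_le:
      "(\<And>k i. i \<in> {1..X} \<Longrightarrow> action_value X c P (\<lambda>j. \<rho> * V j) i (\<nu> k i) \<le> V i) \<Longrightarrow>
        discounted_cost \<rho> P c \<nu> x0 \<le> V x0"
proof -
  interpret controlled_chain X UNIV "\<lambda>_. P" \<nu> x0
    using P by (intro controlled_chain_policy[OF _ \<nu> x0])
  obtain C where C: "\<And>i u. i \<in> {1..X} \<Longrightarrow> u \<in> {1..U} \<Longrightarrow> \<bar>c i u\<bar> \<le> C"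
    using abs_bounded_on_finite[of "{1..X} \<times> {1..U}" "\<lambda>(i, u). c i u"] by fastforce
  obtain B where B: "\<And>i. i \<in> {1..X} \<Longrightarrow> \<bar>V i\<bar> \<le> B"
    using abs_bounded_on_finite[of "{1..X}" V] by blast
  have "(\<lambda>k. \<rho> ^ k * expect k (\<lambda>i. c i (\<nu> k i))) sums discounted_cost \<rho> P c \<nu> x0"
    unfolding discounted_cost_def
    using C policies_D[OF \<nu>] by (intro integral_discounted_sum[OF refl \<rho>, of _ C]) auto
  moreover have "(\<lambda>n. \<rho> ^ n * expect n V) \<longlonglongrightarrow> 0"
  proof (rule Lim_null_comparison)
    show "\<forall>\<^sub>F n in sequentially. norm (\<rho> ^ n * expect n V) \<le> \<rho> ^ n * B"
      using abs_expect_le[of _ V B] B \<rho>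
      by (intro always_eventually allI) (auto simp: abs_mult intro!: mult_left_mono)
    show "(\<lambda>n. \<rho> ^ n * B) \<longlonglongrightarrow> 0"
      using \<rho> by (intro tendsto_mult_left_zero LIMSEQ_realpow_zero)
  qed
  ultimately have lim: "(\<lambda>n. (\<Sum>k<n. \<rho> ^ k * expect k (\<lambda>i. c i (\<nu> k i))) + \<rho> ^ n * expect n V)
      \<longlonglongrightarrow> discounted_cost \<rho> P c \<nu> x0"
    unfolding sums_def by (rule tendsto_add[where b = 0, simplified])
  show "V x0 \<le> discounted_cost \<rho> P c \<nu> x0"
    if "\<And>k i. i \<in> {1..X} \<Longrightarrow> V i \<le> action_value X c P (\<lambda>j. \<rho> * V j) i (\<nu> k i)"
    using discounted_lower_bound[of _ \<rho> "\<lambda>_. V" "\<lambda>_. c"] that \<rho>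
    by (intro LIMSEQ_le_const[OF lim]) auto
  show "discounted_cost \<rho> P c \<nu> x0 \<le> V x0"
    if "\<And>k i. i \<in> {1..X} \<Longrightarrow> action_value X c P (\<lambda>j. \<rho> * V j) i (\<nu> k i) \<le> V i"
    using discounted_upper_bound[of _ \<rho> "\<lambda>_. c" "\<lambda>_. V"] that \<rho>
    by (intro LIMSEQ_le_const2[OF lim]) auto
qed

lemma mono_on_greedy_discounted:
  assumes "1 \<le> X" "1 \<le> U" "transitions_within X U P" "submodular_cost X U c"
    and "tail_sum_supermodular X U P" "antimono_on {1..X} V" "0 \<le> \<rho>"
  shows "mono_on {1..X} (greedy U (action_value X c P (\<lambda>j. \<rho> * V j)))"
proof -
  have "antimono_on {1..X} (\<lambda>j. \<rho> * V j)"
    using assms(6,7) by (auto simp: monotone_on_def intro!: mult_left_mono)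
  with assms show ?thesis
    by (intro mono_on_greedy submodular_action_value)
qed

lemma discounted_monotone_policy:
  assumes X: "1 \<le> X" and U: "1 \<le> U" and P: "transitions_within X U P"
    and c: "decreasing_cost X U c" and inc: "stoch_increasing X U P"
    and sub: "submodular_cost X U c" and super: "tail_sum_supermodular X U P"
    and \<rho>: "0 \<le> \<rho>" "\<rho> < 1"
  shows "\<exists>\<mu>. optimal_policy X (policies UNIV X U) (discounted_cost \<rho> P c) (\<lambda>_. \<mu>) \<and>
    mono_on {1..X} \<mu>"
proof -
  obtain V where V: "antimono_on {1..X} V" "bellman_fixpoint X U P c \<rho> V"
    by (rule bellman_fixpoint_exists[OF X U P c inc \<rho>])
  define \<mu> where "\<mu> = greedy U (action_value X c P (\<lambda>j. \<rho> * V j))"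
  have \<mu>_in: "(\<lambda>_. \<mu>) \<in> policies UNIV X U"
    using greedy_in[OF U] by (auto simp: policies_def \<mu>_def)
  have "discounted_cost \<rho> P c (\<lambda>_. \<mu>) x0 \<le> discounted_cost \<rho> P c \<nu> x0"
    if \<nu>: "\<nu> \<in> policies UNIV X U" and x0: "x0 \<in> {1..X}" for \<nu> x0
  proof -
    have "discounted_cost \<rho> P c (\<lambda>_. \<mu>) x0 \<le> V x0"
      using bellman_fixpoint_greedy[OF V(2) _ U]
      by (intro discounted_cost_le[OF P \<mu>_in x0 \<rho>]) (simp add: \<mu>_def)
    also have "\<dots> \<le> discounted_cost \<rho> P c \<nu> x0"
      using policies_D[OF \<nu>]
      by (intro discounted_cost_ge[OF P \<nu> x0 \<rho>] bellman_fixpoint_le[OF V(2)]) auto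
    finally show ?thesis .
  qed
  with \<mu>_in mono_on_greedy_discounted[OF X U P sub super V(1) \<rho>(1)] show ?thesis
    unfolding optimal_policy_def \<mu>_def[symmetric] by blast
qed

section \<open>Vanishing discount limit\<close>

lemma convergent_subseq_pointwise:
  fixes f :: "nat \<Rightarrow> 'a \<Rightarrow> real"
  assumes "finite S" and "\<And>m i. i \<in> S \<Longrightarrow> \<bar>f m i\<bar> \<le> C"
  shows "\<exists>r :: nat \<Rightarrow> nat. strict_mono r \<and> (\<forall>i\<in>S. convergent (\<lambda>m. f (r m) i))"
  using assms
proof (induction S)
  case empty
  show ?case by (intro exI[of _ id]) (auto simp: strict_mono_def)
next
  case (insert x S)
  then obtain r where r: "strict_mono r" "\<forall>i\<in>S. convergent (\<lambda>m. f (r m) i)"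
    by auto
  have "bounded (range (\<lambda>m. f (r m) x))"
    using insert.prems[of x] by (auto simp: bounded_iff)
  then obtain l r' where r': "strict_mono r'" "((\<lambda>m. f (r m) x) \<circ> r') \<longlonglongrightarrow> l"
    using bounded_imp_convergent_subsequence by blast
  \<comment> \<open>Refining the subsequence for \<open>x\<close> keeps the convergence already
    obtained on \<open>S\<close>, so no diagonal argument is required.\<close>
  have "convergent (\<lambda>m. f (r (r' m)) i)" if "i \<in> insert x S" for i
    using that r(2) convergent_subseq_convergent[OF _ r'(1), of "\<lambda>m. f (r m) i"] convergentI[OF r'(2)]
    by (auto simp: o_def)
  then show ?case
    using strict_mono_o[OF r(1) r'(1)] by (intro exI[of _ "\<lambda>m. r (r' m)"]) (auto simp: o_def)
qed

text \<open>At a state where the absolute value of \<open>V\<close> attains its maximum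
  \<open>M\<close>, the Bellman equation gives \<open>M \<le> C + \<rho> * M\<close>. The resulting
  bound \<open>C\<close> does not depend on the discount factor, which yields compactness
  below.\<close>

lemma scaled_bellman_fixpoint_bound:
  assumes X: "1 \<le> X" and U: "1 \<le> U" and P: "transitions_within X U P"
    and V: "bellman_fixpoint X U P c \<rho> V" and \<rho>: "0 \<le> \<rho>" "\<rho> < 1"
    and C: "\<And>i u. i \<in> {1..X} \<Longrightarrow> u \<in> {1..U} \<Longrightarrow> \<bar>c i u\<bar> \<le> C" and i: "i \<in> {1..X}"
  shows "\<bar>(1 - \<rho>) * V i\<bar> \<le> C"
proof -
  define M where "M = Max ((\<lambda>i. \<bar>V i\<bar>) ` {1..X})"
  have le: "\<bar>V j\<bar> \<le> M" if "j \<in> {1..X}" for j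
    unfolding M_def using that by (intro Max_ge) auto
  have "M \<in> (\<lambda>i. \<bar>V i\<bar>) ` {1..X}"
    unfolding M_def using X by (intro Max_in) auto
  then obtain m where m: "m \<in> {1..X}" "M = \<bar>V m\<bar>"
    by auto
  define u where "u = greedy U (action_value X c P (\<lambda>j. \<rho> * V j)) m"
  have u: "u \<in> {1..U}"
    unfolding u_def by (rule greedy_in[OF U])
  have "\<bar>action_value X c P (\<lambda>j. \<rho> * V j) m u - action_value X c P (\<lambda>_. 0) m u\<bar> \<le> \<rho> * M"
    using le \<rho> by (intro abs_action_value_diff_le[OF P m(1) u]) (auto simp: abs_mult mult_left_mono)
  then have "\<bar>V m - c m u\<bar> \<le> \<rho> * M"
    using bellman_fixpoint_greedy[OF V m(1) U] by (simp add: u_def action_value_def)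
  then have "M \<le> C + \<rho> * M"
    using C[OF m(1) u] m(2) by linarith
  then have "(1 - \<rho>) * M \<le> C"
    by (simp add: algebra_simps)
  moreover have "(1 - \<rho>) * \<bar>V i\<bar> \<le> (1 - \<rho>) * M"
    using le[OF i] \<rho> by (intro mult_left_mono) auto
  moreover have "\<bar>(1 - \<rho>) * V i\<bar> = (1 - \<rho>) * \<bar>V i\<bar>"
    using \<rho> by (simp add: abs_mult)
  ultimately show ?thesis
    by linarith
qed

text \<open>The limit \<open>g\<close> loses the costs, which carry the factor
  \<open>1 - \<rho>\<close>. The last clause therefore keeps, for each tolerance, one discounted
  fixed point with the same policy: it links \<open>g\<close> to the costs and is bounded while the
  number of steps grows.\<close>

lemma vanishing_discount:
  assumes X: "1 \<le> X" and U: "1 \<le> U" and P: "transitions_within X U P"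
    and c: "decreasing_cost X U c" and inc: "stoch_increasing X U P"
    and sub: "submodular_cost X U c" and super: "tail_sum_supermodular X U P"
  obtains \<mu> g where "\<mu> \<in> {1..X} \<rightarrow> {1..U}" "mono_on {1..X} \<mu>"
    and "\<And>i u. i \<in> {1..X} \<Longrightarrow> u \<in> {1..U} \<Longrightarrow> g i \<le> (\<Sum>j=1..X. pmf (P i u) j * g j)"
    and "\<And>i. i \<in> {1..X} \<Longrightarrow> (\<Sum>j=1..X. pmf (P i (\<mu> i)) j * g j) = g i"
    and "\<And>\<delta>::real. 0 < \<delta> \<Longrightarrow> \<exists>\<rho> V. bellman_fixpoint X U P c \<rho> V \<and>
      (\<forall>i\<in>{1..X}. V i = action_value X c P (\<lambda>j. \<rho> * V j) i (\<mu> i) \<and> \<bar>(1 - \<rho>) * V i - g i\<bar> \<le> \<delta>)"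
proof -
  define \<rho> where "\<rho> m = 1 - inverse (real (Suc m))" for m
  have \<rho>: "0 \<le> \<rho> m" "\<rho> m < 1" for m
    by (auto simp: \<rho>_def field_simps)
  have \<rho>_lim: "\<rho> \<longlonglongrightarrow> 1"
    using tendsto_diff[OF tendsto_const LIMSEQ_inverse_real_of_nat, of 1] by (simp add: \<rho>_def[abs_def])
  have "\<exists>V. antimono_on {1..X} V \<and> bellman_fixpoint X U P c (\<rho> m) V" for m
    using bellman_fixpoint_exists[OF X U P c inc \<rho>] by blast
  then obtain V where V: "\<And>m. antimono_on {1..X} (V m)" "\<And>m. bellman_fixpoint X U P c (\<rho> m) (V m)"
    by metis
  define \<mu> where "\<mu> m = greedy U (action_value X c P (\<lambda>j. \<rho> m * V m j))" for m
  have \<mu>_in: "\<mu> m i \<in> {1..U}" for m i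
    unfolding \<mu>_def by (rule greedy_in[OF U])
  \<comment> \<open>Greedy policies are compared on \<open>{1..X}\<close> only; restricted there
    they form a finite set, so one of them recurs infinitely often.\<close>
  have "finite (range (\<lambda>m. restrict (\<mu> m) {1..X}))"
    by (rule finite_subset[OF _ finite_PiE[of "{1..X}" "\<lambda>_. {1..U}"]]) (use \<mu>_in in auto)
  then obtain m0 where "infinite {m \<in> UNIV. restrict (\<mu> m) {1..X} = restrict (\<mu> m0) {1..X}}"
    using pigeonhole_infinite[of UNIV "\<lambda>m. restrict (\<mu> m) {1..X}"] by auto
  then obtain a :: "nat \<Rightarrow> nat" where a: "strict_mono a"
    "\<And>n. restrict (\<mu> (a n)) {1..X} = restrict (\<mu> m0) {1..X}"
    using infinite_enumerate by blast
  obtain C where C: "\<And>i u. i \<in> {1..X} \<Longrightarrow> u \<in> {1..U} \<Longrightarrow> \<bar>c i u\<bar> \<le> C"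
    using abs_bounded_on_finite[of "{1..X} \<times> {1..U}" "\<lambda>(i, u). c i u"] by fastforce
  define h where "h m i = (1 - \<rho> m) * V m i" for m i
  have "\<bar>h (a m) i\<bar> \<le> C" if "i \<in> {1..X}" for m i
    unfolding h_def using C that by (rule scaled_bellman_fixpoint_bound[OF X U P V(2) \<rho>])
  then obtain r where r: "strict_mono r" "\<And>i. i \<in> {1..X} \<Longrightarrow> convergent (\<lambda>m. h (a (r m)) i)"
    using convergent_subseq_pointwise[of "{1..X}" "\<lambda>m. h (a m)" C] by auto
  define s where "s m = a (r m)" for m
  define \<sigma> where "\<sigma> = \<mu> m0"
  have \<sigma>: "\<mu> (s m) i = \<sigma> i" if "i \<in> {1..X}" for m i
    using a(2)[of "r m"] that unfolding s_def \<sigma>_def by (metis restrict_apply')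
  obtain g where g: "\<And>i. i \<in> {1..X} \<Longrightarrow> (\<lambda>m. h (s m) i) \<longlonglongrightarrow> g i"
    using r(2) unfolding s_def convergent_def by metis
  have "strict_mono s"
    using strict_mono_o[OF a(1) r(1)] by (simp add: s_def[abs_def] o_def)
  then have \<rho>s: "(\<lambda>m. \<rho> (s m)) \<longlonglongrightarrow> 1"
    using LIMSEQ_subseq_LIMSEQ[OF \<rho>_lim] by (simp add: o_def)
  \<comment> \<open>Scaling the Bellman equation by \<open>1 - \<rho> m\<close> rewrites it in terms
    of \<open>h\<close>, with a cost term that disappears in the limit.\<close>
  have scaled: "(1 - \<rho> m) * action_value X c P (\<lambda>j. \<rho> m * V m j) i u =
      (1 - \<rho> m) * c i u + \<rho> m * (\<Sum>j=1..X. pmf (P i u) j * h m j)" for m i u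
    by (simp add: action_value_def h_def sum_distrib_left algebra_simps)
  have lim: "(\<lambda>m. (1 - \<rho> (s m)) * c i u + \<rho> (s m) * (\<Sum>j=1..X. pmf (P i u) j * h (s m) j))
      \<longlonglongrightarrow> (1 - 1) * c i u + 1 * (\<Sum>j=1..X. pmf (P i u) j * g j)" for i u
    by (intro tendsto_intros \<rho>s g)
  show thesis
  proof (rule that[of \<sigma> g])
    show "\<sigma> \<in> {1..X} \<rightarrow> {1..U}"
      using \<mu>_in by (simp add: \<sigma>_def)
    show "mono_on {1..X} \<sigma>"
      \<comment> \<open>\<open>\<sigma>\<close> is itself greedy for the single discount factor
        \<open>\<rho> m0\<close>, so its monotonicity involves no limit.\<close>
      unfolding \<sigma>_def \<mu>_def by (rule mono_on_greedy_discounted[OF X U P sub super V(1) \<rho>(1)])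
  next
    fix i u assume i: "i \<in> {1..X}" and u: "u \<in> {1..U}"
    have "h m i \<le> (1 - \<rho> m) * c i u + \<rho> m * (\<Sum>j=1..X. pmf (P i u) j * h m j)" for m
      unfolding scaled[symmetric] unfolding h_def
      using \<rho>[of m] bellman_fixpoint_le[OF V(2) i u] by (intro mult_left_mono) auto
    then show "g i \<le> (\<Sum>j=1..X. pmf (P i u) j * g j)"
      using LIMSEQ_le[OF g[OF i] lim[of i u]] by simp
  next
    fix i assume i: "i \<in> {1..X}"
    have "h (s m) i = (1 - \<rho> (s m)) * c i (\<sigma> i) + \<rho> (s m) * (\<Sum>j=1..X. pmf (P i (\<sigma> i)) j * h (s m) j)" for m
      using bellman_fixpoint_greedy[OF V(2)[of "s m"] i U]
      unfolding scaled[symmetric] \<mu>_def[symmetric] \<sigma>[OF i] unfolding h_def by simp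
    then show "(\<Sum>j=1..X. pmf (P i (\<sigma> i)) j * g j) = g i"
      using LIMSEQ_unique[OF g[OF i]] lim[of i "\<sigma> i"] by simp
  next
    fix \<delta> :: real assume "0 < \<delta>"
    have "\<forall>\<^sub>F m in sequentially. \<forall>i\<in>{1..X}. \<bar>h (s m) i - g i\<bar> < \<delta>"
      using tendstoD[OF g \<open>0 < \<delta>\<close>] by (intro eventually_ball_finite) (auto simp: dist_real_def)
    then have "\<exists>m. \<forall>i\<in>{1..X}. \<bar>h (s m) i - g i\<bar> < \<delta>"
      by (rule eventually_happens'[OF sequentially_bot])
    then obtain m where m: "\<forall>i\<in>{1..X}. \<bar>h (s m) i - g i\<bar> < \<delta>"
      by blast
    have "V (s m) i = action_value X c P (\<lambda>j. \<rho> (s m) * V (s m) j) i (\<sigma> i)" if "i \<in> {1..X}" for i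
      using bellman_fixpoint_greedy[OF V(2)[of "s m"] that U]
      unfolding \<mu>_def[symmetric] \<sigma>[OF that] .
    with m V(2)[of "s m"] show "\<exists>\<rho> V. bellman_fixpoint X U P c \<rho> V \<and>
      (\<forall>i\<in>{1..X}. V i = action_value X c P (\<lambda>j. \<rho> * V j) i (\<sigma> i) \<and> \<bar>(1 - \<rho>) * V i - g i\<bar> \<le> \<delta>)"
      unfolding h_def by (intro exI[of _ "\<rho> (s m)"] exI[of _ "V (s m)"]) (auto simp: less_imp_le)
  qed
qed

section \<open>Average cost\<close>

lemma average_monotone_policy:
  assumes X: "1 \<le> X" and U: "1 \<le> U" and P: "transitions_within X U P"
    and c: "decreasing_cost X U c" and inc: "stoch_increasing X U P"
    and sub: "submodular_cost X U c" and super: "tail_sum_supermodular X U P"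
  shows "\<exists>\<mu>. optimal_policy X (policies UNIV X U) (average_cost P c) (\<lambda>_. \<mu>) \<and> mono_on {1..X} \<mu>"
proof (rule vanishing_discount[OF X U P c inc sub super])
  fix \<mu> g
  assume \<mu>: "\<mu> \<in> {1..X} \<rightarrow> {1..U}" "mono_on {1..X} \<mu>"
    and g_le: "\<And>i u. i \<in> {1..X} \<Longrightarrow> u \<in> {1..U} \<Longrightarrow> g i \<le> (\<Sum>j=1..X. pmf (P i u) j * g j)"
    and g_eq: "\<And>i. i \<in> {1..X} \<Longrightarrow> (\<Sum>j=1..X. pmf (P i (\<mu> i)) j * g j) = g i"
    and approx: "\<And>\<delta>::real. 0 < \<delta> \<Longrightarrow> \<exists>\<rho> V. bellman_fixpoint X U P c \<rho> V \<and>
      (\<forall>i\<in>{1..X}. V i = action_value X c P (\<lambda>j. \<rho> * V j) i (\<mu> i) \<and> \<bar>(1 - \<rho>) * V i - g i\<bar> \<le> \<delta>)"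
  have \<mu>_in: "(\<lambda>_. \<mu>) \<in> policies UNIV X U"
    using \<mu>(1) by (auto simp: policies_def)
  have average: "average_cost P c \<nu> x0 = limsup (\<lambda>n. ereal
      ((\<Sum>k<n. controlled_chain.expect (\<lambda>_. P) \<nu> x0 k (\<lambda>i. c i (\<nu> k i))) / real n))"
    if "controlled_chain X UNIV (\<lambda>_. P) \<nu> x0" for \<nu> x0
    using controlled_chain.integral_total[OF that, of _ "\<lambda>k i. c i (\<nu> k i)"]
    by (simp add: average_cost_def)
  have null: "\<forall>\<^sub>F n in sequentially. 0 < n \<and> B / real n < \<delta>" if "0 < \<delta>" for B \<delta> :: real
    using order_tendstoD(2)[OF lim_const_over_n[of B] that] eventually_gt_at_top[of 0]
    by eventually_elim simp
  have "average_cost P c (\<lambda>_. \<mu>) x0 \<le> average_cost P c \<nu> x0"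
    if \<nu>: "\<nu> \<in> policies UNIV X U" and x0: "x0 \<in> {1..X}" for \<nu> x0
  proof -
    interpret opt: controlled_chain X UNIV "\<lambda>_. P" "\<lambda>_. \<mu>" x0
      using P by (intro controlled_chain_policy[OF _ \<mu>_in x0])
    interpret alt: controlled_chain X UNIV "\<lambda>_. P" \<nu> x0
      using P by (intro controlled_chain_policy[OF _ \<nu> x0])
    \<comment> \<open>One half of \<open>\<epsilon>\<close> pays for the distance between
      \<open>(1 - \<rho>) * V\<close> and \<open>g\<close>, the other for the end terms
      \<open>2 * B / n\<close>. Since \<open>V\<close> is chosen before \<open>n\<close>, its bound
      \<open>B\<close> is constant as \<open>n\<close> grows.\<close>
    have upper: "average_cost P c (\<lambda>_. \<mu>) x0 \<le> ereal (g x0) + ereal \<epsilon>" if "0 < \<epsilon>" for \<epsilon>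
    proof -
      obtain \<rho> V where "\<forall>i\<in>{1..X}. V i = action_value X c P (\<lambda>j. \<rho> * V j) i (\<mu> i) \<and>
          \<bar>(1 - \<rho>) * V i - g i\<bar> \<le> \<epsilon> / 2"
        using approx[of "\<epsilon> / 2"] half_gt_zero[OF \<open>0 < \<epsilon>\<close>] by blast
      then have V: "action_value X c P (\<lambda>j. \<rho> * V j) i (\<mu> i) \<le> V i"
        "(1 - \<rho>) * V i \<le> g i + \<epsilon> / 2" if "i \<in> {1..X}" for i
        using that unfolding abs_le_iff by (metis order_refl, fastforce)
      obtain B where B: "\<And>i. i \<in> {1..X} \<Longrightarrow> \<bar>V i\<bar> \<le> B"
        using abs_bounded_on_finite[of "{1..X}" V] by blast
      have bound: "(\<Sum>k<n. opt.expect k (\<lambda>i. c i (\<mu> i))) \<le> real n * (g x0 + \<epsilon> / 2) + 2 * B" for n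
        using V B g_eq by (intro opt.total_upper_bound[of n c \<rho> V g "\<epsilon> / 2" B]) auto
      have "\<forall>\<^sub>F n in sequentially. 0 < n \<and> 2 * B / real n < \<epsilon> / 2"
        using \<open>0 < \<epsilon>\<close> by (intro null) simp
      then have "\<forall>\<^sub>F n in sequentially.
          ereal ((\<Sum>k<n. opt.expect k (\<lambda>i. c i (\<mu> i))) / real n) \<le> ereal (g x0 + \<epsilon>)"
      proof eventually_elim
        case (elim n)
        then have "2 * B \<le> \<epsilon> / 2 * real n"
          by (auto simp: pos_divide_less_eq)
        with bound[of n] have "(\<Sum>k<n. opt.expect k (\<lambda>i. c i (\<mu> i))) \<le> (g x0 + \<epsilon>) * real n"
          by (simp add: algebra_simps)
        with elim show ?case
          by (simp add: pos_divide_le_eq)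
      qed
      then show ?thesis
        unfolding average[OF opt.controlled_chain_axioms] plus_ereal.simps by (rule Limsup_bounded)
    qed
    have lower: "ereal (g x0) \<le> average_cost P c \<nu> x0 + ereal \<epsilon>" if "0 < \<epsilon>" for \<epsilon>
    proof -
      obtain \<rho> V where V: "bellman_fixpoint X U P c \<rho> V"
        "\<forall>i\<in>{1..X}. \<bar>(1 - \<rho>) * V i - g i\<bar> \<le> \<epsilon> / 2"
        using approx[of "\<epsilon> / 2"] half_gt_zero[OF \<open>0 < \<epsilon>\<close>] by blast
      have V_ge: "g i - \<epsilon> / 2 \<le> (1 - \<rho>) * V i" if "i \<in> {1..X}" for i
        using bspec[OF V(2) that] by linarith
      obtain B where B: "\<And>i. i \<in> {1..X} \<Longrightarrow> \<bar>V i\<bar> \<le> B"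
        using abs_bounded_on_finite[of "{1..X}" V] by blast
      have bound: "real n * (g x0 - \<epsilon> / 2) - 2 * B \<le> (\<Sum>k<n. alt.expect k (\<lambda>i. c i (\<nu> k i)))" for n
        using V_ge B policies_D[OF \<nu>]
        by (intro alt.total_lower_bound[of n V c \<rho> g "\<epsilon> / 2" B] bellman_fixpoint_le[OF V(1)] g_le) auto
      have "\<forall>\<^sub>F n in sequentially. 0 < n \<and> 2 * B / real n < \<epsilon> / 2"
        using \<open>0 < \<epsilon>\<close> by (intro null) simp
      then have "\<forall>\<^sub>F n in sequentially.
          ereal (g x0 - \<epsilon>) \<le> ereal ((\<Sum>k<n. alt.expect k (\<lambda>i. c i (\<nu> k i))) / real n)"
      proof eventually_elim
        case (elim n)
        then have "2 * B \<le> \<epsilon> / 2 * real n"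
          by (auto simp: pos_divide_less_eq)
        with bound[of n] have "(g x0 - \<epsilon>) * real n \<le> (\<Sum>k<n. alt.expect k (\<lambda>i. c i (\<nu> k i)))"
          by (simp add: algebra_simps)
        with elim show ?case
          by (simp add: pos_le_divide_eq)
      qed
      \<comment> \<open>The estimate bounds even the liminf of the averages, and the limsup lies
        above it.\<close>
      then have "ereal (g x0 - \<epsilon>) \<le> average_cost P c \<nu> x0"
        unfolding average[OF alt.controlled_chain_axioms]
        by (rule order_trans[OF Liminf_bounded Liminf_le_Limsup[OF sequentially_bot]])
      then show ?thesis
        by (cases "average_cost P c \<nu> x0") auto
    qed
    have "average_cost P c (\<lambda>_. \<mu>) x0 \<le> ereal (g x0)"
      using upper by (rule ereal_le_epsilon2)
    also have "\<dots> \<le> average_cost P c \<nu> x0"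
      using lower by (rule ereal_le_epsilon2)
    finally show ?thesis .
  qed
  with \<mu>_in \<mu>(2) show ?thesis
    unfolding optimal_policy_def by blast
qed

theorem theorem3p3p1:
  fixes X U :: nat
  assumes "1 \<le> X" and "1 \<le> U"
  shows
    "(\<forall>(N::nat) (P :: nat \<Rightarrow> nat \<Rightarrow> nat \<Rightarrow> nat pmf) (c :: nat \<Rightarrow> nat \<Rightarrow> nat \<Rightarrow> real) (cN :: nat \<Rightarrow> real).
        (\<forall>k<N. transitions_within X U (P k)) \<longrightarrow>
        (\<forall>k<N. decreasing_cost X U (c k)) \<and> antimono_on {1..X} cN \<longrightarrow>
        (\<forall>k<N. stoch_increasing X U (P k)) \<longrightarrow>
        (\<forall>k<N. submodular_cost X U (c k)) \<longrightarrow>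
        (\<forall>k<N. tail_sum_supermodular X U (P k)) \<longrightarrow>
        (\<exists>\<mu>. optimal_policy X (policies {..<N} X U) (finite_horizon_cost N P c cN) \<mu> \<and>
             bellman_policy X U N P c cN \<mu> \<and>
             (\<forall>k<N. mono_on {1..X} (\<mu> k)))) \<and>
     (\<forall>(P :: nat \<Rightarrow> nat \<Rightarrow> nat pmf) (c :: nat \<Rightarrow> nat \<Rightarrow> real).
        transitions_within X U P \<longrightarrow>
        decreasing_cost X U c \<longrightarrow>
        stoch_increasing X U P \<longrightarrow>
        submodular_cost X U c \<longrightarrow>
        tail_sum_supermodular X U P \<longrightarrow>
        (\<forall>\<rho>::real. 0 \<le> \<rho> \<and> \<rho> < 1 \<longrightarrow>
           (\<exists>\<mu>. optimal_policy X (policies UNIV X U) (discounted_cost \<rho> P c) (\<lambda>_. \<mu>) \<and>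
                mono_on {1..X} \<mu>)) \<and>
        (unichain X U P \<longrightarrow>
           (\<exists>\<mu>. optimal_policy X (policies UNIV X U) (average_cost P c) (\<lambda>_. \<mu>) \<and>
                mono_on {1..X} \<mu>)))"
proof (intro conjI allI impI; (elim conjE)?)
  fix N :: nat and P :: "nat \<Rightarrow> nat \<Rightarrow> nat \<Rightarrow> nat pmf" and c :: "nat \<Rightarrow> nat \<Rightarrow> nat \<Rightarrow> real"
    and cN :: "nat \<Rightarrow> real"
  assume "\<forall>k<N. transitions_within X U (P k)" "\<forall>k<N. decreasing_cost X U (c k)"
    "antimono_on {1..X} cN" "\<forall>k<N. stoch_increasing X U (P k)"
    "\<forall>k<N. submodular_cost X U (c k)" "\<forall>k<N. tail_sum_supermodular X U (P k)"
  then show "\<exists>\<mu>. optimal_policy X (policies {..<N} X U) (finite_horizon_cost N P c cN) \<mu> \<and>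
      bellman_policy X U N P c cN \<mu> \<and> (\<forall>k<N. mono_on {1..X} (\<mu> k))"
    using assms by (intro finite_horizon_monotone_policy) auto
qed (rule discounted_monotone_policy[OF assms] average_monotone_policy[OF assms]; assumption)+

end
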